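(* Let $d\ge1$, let $f\in\mathcal{S}_d$ be a standard Schur function, and let $r:\mathbb{Z}_+\to\mathbb{D}$ be its sequence of Schur parameters. Then $$\int_{\mathbb{T}^d}\log(1-|f^\circ|^2)\,d\tau=\sum_{j=1}^\infty\log(1-|r_j|^2).$$ This equation is valid irrespective of whether the left and right-hand sides are finite or infinite (i.e. equal to $-\infty$). The values are finite if and only if $r\in\ell^2(\mathbb{Z}_+)$.
   Context: Notation. $\mathbb{D}$ is the open unit disk, $\overline{\mathbb{D}}$ its closure, $\mathbb{T}$ the unit circle, $\mathbb{Z}_+$ the nonnegative integers. $\tau$ is normalized Lebesgue measure on $\mathbb{T}^d$. $\mathcal{H}_d$ is the set of all holomorphic functions $h:\mathbb{D}^d\to\overline{\mathbb{D}}$, with the topology of uniform convergence on compact sets. For $h\in\mathcal{H}_d$, $h^\circ(z)=\lim_{s\nearrow1}h(sz)$ is the radial limit, which exists for almost every $z\in\mathbb{T}^d$. $\mathbf{c}_r$ denotes the constant function with value $r$. For $1\le j\le d$ and $r\in\overline{\mathbb{D}}$ define operators on $\mathcal{H}_d$ by $(\mathfrak{m}_jh)(z)=z_jh(z)$; $(\mathfrak{g}_rh)(z)=\frac{h(z)+r}{1+\overline{r}h(z)}$ if $r\in\mathbb{D}$, and $\mathfrak{g}_rh=\mathbf{c}_r$ if $r\in\mathbb{T}$. Schur functions. $\mathcal{S}_d$ is the closure in $\mathcal{H}_d$ of the set of all functions $\mathfrak{g}_{r_0}\mathfrak{m}_{\nu_1}\cdots\mathfrak{g}_{r_{k-1}}\mathfrak{m}_{\nu_k}\mathbf{c}_0$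 with $k\ge1$, $r_i\in\mathbb{D}$, $\nu_i\in\{1,\dots,d\}$; its elements are called Schur functions. Every $f\in\mathcal{S}_d$ can be written $f=\mathfrak{g}_r\mathfrak{m}_jh$ with $r=f(0)$, some $1\le j\le d$, some $h\in\mathcal{S}_d$. Starting with $h_0=f$, iterate: set $r_n=h_n(0)$ and choose $\nu_{n+1}\in\{1,\dots,d\}$, $h_{n+1}\in\mathcal{S}_d$ with $h_n=\mathfrak{g}_{r_n}\mathfrak{m}_{\nu_{n+1}}h_{n+1}$ (if $h_n$ is constant, take $\nu_{n+1}=1$, $h_{n+1}=\mathbf{c}_0$). The numbers $r_n$ $(n\ge0)$, which do not depend on the choices made, are the Schur parameters of $f$. $f$ is standard if $f(0)=0$ and $|r_n|<1$ for all $n\ge0$. *)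

theory Defs
  imports "HOL-Analysis.Analysis"
begin

definition polydisc :: "(complex ^ 'd) set" where
  "polydisc = {z. \<forall>i. cmod (z $ i) < 1}"

(* Holomorphy in several variables: the total derivative exists and is complex-linear. *)
definition holomorphic_several :: "(complex ^ 'd \<Rightarrow> complex) \<Rightarrow> (complex ^ 'd) set \<Rightarrow> bool" where
  "holomorphic_several h U \<longleftrightarrow>
     (\<forall>z\<in>U. \<exists>L. (h has_derivative L) (at z) \<and> (\<forall>c v. L (c *s v) = c * L v))"

(* Functions on the polydisc are represented by total functions; their values off the
   polydisc are irrelevant, and equality of such functions means equality on the polydisc. *)
definition hol_maps :: "(complex ^ 'd \<Rightarrow> complex) set" where
  "hol_maps = {h. holomorphic_several h polydisc \<and> (\<forall>z\<in>polydisc. cmod (h z) \<le> 1)}"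

definition mult_op :: "'d \<Rightarrow> (complex ^ 'd \<Rightarrow> complex) \<Rightarrow> (complex ^ 'd \<Rightarrow> complex)" where
  "mult_op j h = (\<lambda>z. z $ j * h z)"

(* Intended for parameters r in the closed unit disc. *)
definition moebius_op :: "complex \<Rightarrow> (complex ^ 'd \<Rightarrow> complex) \<Rightarrow> (complex ^ 'd \<Rightarrow> complex)" where
  "moebius_op r h = (if cmod r < 1 then (\<lambda>z. (h z + r) / (1 + cnj r * h z)) else (\<lambda>_. r))"

inductive_set elementary_schur :: "(complex ^ 'd \<Rightarrow> complex) set" where
  base: "cmod r < 1 \<Longrightarrow> moebius_op r (mult_op j (\<lambda>_. 0)) \<in> elementary_schur"
| step: "cmod r < 1 \<Longrightarrow> h \<in> elementary_schur \<Longrightarrow> moebius_op r (mult_op j h) \<in> elementary_schur"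

(* Closure within hol_maps for the topology of uniform convergence on compact subsets of
   the polydisc, spelled out through its basic neighbourhoods. *)
definition schur_functions :: "(complex ^ 'd \<Rightarrow> complex) set" where
  "schur_functions = {f \<in> hol_maps. \<forall>K \<epsilon>. compact K \<longrightarrow> K \<subseteq> polydisc \<longrightarrow> \<epsilon> > 0 \<longrightarrow>
     (\<exists>g\<in>elementary_schur. \<forall>z\<in>K. dist (f z) (g z) < \<epsilon>)}"

(* A relation between f and r because the algorithm involves choices; the resulting r is
   unique.  If h n is constant, the index \<nu> (Suc n) is left free: it has no effect, since
   h (Suc n) is then zero. *)
definition schur_parameters :: "(complex ^ 'd \<Rightarrow> complex) \<Rightarrow> (nat \<Rightarrow> complex) \<Rightarrow> bool" where
  "schur_parameters f r \<longleftrightarrow>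
     (\<exists>(h :: nat \<Rightarrow> complex ^ 'd \<Rightarrow> complex) (\<nu> :: nat \<Rightarrow> 'd). h 0 = f \<and>
       (\<forall>n. h n \<in> schur_functions \<and> r n = h n 0 \<and>
            (\<forall>z\<in>polydisc. h n z = moebius_op (r n) (mult_op (\<nu> (Suc n)) (h (Suc n))) z) \<and>
            (h n constant_on polydisc \<longrightarrow> (\<forall>z\<in>polydisc. h (Suc n) z = 0))))"

(* The quantifier over r ranges over the one parameter sequence of f. *)
definition standard_schur :: "(complex ^ 'd \<Rightarrow> complex) \<Rightarrow> bool" where
  "standard_schur f \<longleftrightarrow> f \<in> schur_functions \<and> f 0 = 0 \<and>
     (\<forall>r. schur_parameters f r \<longrightarrow> (\<forall>n. cmod (r n) < 1))"

(* An unspecified value at points where the limit does not exist. *)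
definition radial_limit :: "(complex ^ 'd \<Rightarrow> complex) \<Rightarrow> complex ^ 'd \<Rightarrow> complex" where
  "radial_limit h z = Lim (at_left 1) (\<lambda>s::real. h (s *\<^sub>R z))"

(* Normalized Lebesgue measure on the torus, as a Borel probability measure on the ambient
   space that is concentrated on the torus. *)
definition torus_measure :: "(complex ^ 'd) measure" where
  "torus_measure =
     distr (uniform_measure lborel (cbox 0 (\<chi> i. 2 * pi))) borel
       (\<lambda>\<theta> :: real ^ 'd. \<chi> i. cis (\<theta> $ i))"

(* Logarithm on [0, \<infinity>) with log 0 = -\<infinity>; the library has ln 0 = 0 on the reals. *)
definition ext_ln :: "real \<Rightarrow> ereal" where
  "ext_ln x = (if x \<le> 0 then -\<infinity> else ereal (ln x))"

(* Lebesgue integral of an extended real function, positive minus negative part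
   (e2ennreal truncates at 0); meaningful when at most one of the parts is infinite. *)
definition ext_integral :: "'a measure \<Rightarrow> ('a \<Rightarrow> ereal) \<Rightarrow> ereal" where
  "ext_integral M g =
     enn2ereal (\<integral>\<^sup>+ x. e2ennreal (g x) \<partial>M) - enn2ereal (\<integral>\<^sup>+ x. e2ennreal (- g x) \<partial>M)"

end

theory Submission
  imports Defs "HOL-Complex_Analysis.Conformal_Mappings" "HOL-Probability.Probability_Measure"
begin

text \<open>
  For a function \<open>h\<close> bounded by one, consider the integral of \<open>- ln (1 - (cmod h)\<^sup>2)\<close> over the torus,
  taken for the radial boundary values. Let \<open>h 0 = f\<close>, \<open>h 1\<close>, \<open>h 2\<close> and so on be the iterates of
  the Schur algorithm. One step expresses \<open>h n\<close> through \<open>a = z $ \<nu> n * h (Suc n) z\<close> by a disc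
  automorphism with denominator \<open>1 + cnj (r n) * a\<close>, and
    \<open>1 - (cmod (h n z))\<^sup>2 = (1 - (cmod (r n))\<^sup>2) * (1 - (cmod a)\<^sup>2) / (cmod (1 + cnj (r n) * a))\<^sup>2\<close>
  (\<open>disc_automorphism_defect\<close>). On the torus \<open>a\<close> and \<open>h (Suc n)\<close> have the same modulus. The logarithm of
  the denominator has mean zero, because the denominator is holomorphic without zeros and takes the
  value one where the coordinate \<open>z $ \<nu> n\<close> vanishes (\<open>integral_ln_denom\<close>). Hence each step
  splits the amount \<open>loss n = - ln (1 - (cmod (r n))\<^sup>2)\<close> off the integral. What remains to be shown is
  that nothing is lost in the limit of infinitely many steps.

  The integral is at least every partial sum of the losses: the boundary values of all \<open>h n\<close> exist wherever
  those of \<open>f\<close> do, the remaining integral after \<open>N\<close> steps is nonnegative, and the logarithms of the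
  denominators are bounded, so their boundary values still have mean zero
  (\<open>sum_loss_le_boundary_deficit\<close>).

  For the opposite inequality the integrals are taken over the torus of radius \<open>s < 1\<close>. There one has
  \<open>cmod a = s * cmod (h (Suc n))\<close>, and since \<open>- ln (1 - x)\<close> is convex and vanishes at zero, the
  next integral enters with a factor \<open>s\<^sup>2\<close> (\<open>mean_energy_step\<close>). If the losses are summable, the integrals for
  a fixed \<open>s\<close> are bounded uniformly in \<open>n\<close> (\<open>mean_energy_le\<close>), so the remainder after \<open>N\<close> steps decays
  like \<open>s\<close> to the power \<open>2 * N\<close> and the integral over radius \<open>s\<close> is at most the sum of all losses. Fatou's
  lemma takes this bound to the boundary (\<open>boundary_deficit_le_suminf_loss\<close>).

  The radial limits have to exist almost everywhere. On the torus this follows from the disc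
  by restricting to the complex lines through the origin and using translation invariance of Lebesgue measure in the
  angles (\<open>AE_radial_limit_exists\<close>). In the disc it is Fatou's theorem (\<open>Fatou_radial_limits\<close>), which is derived
  here from the almost everywhere differentiability of Lipschitz functions on the line: a primitive of a
  bounded holomorphic function is Lipschitz up to the circle, and where it is differentiable along the
  circle, a maximum principle argument gives the radial limit of its derivative.
\<close>

section \<open>Differentiability of Lipschitz functions on the line\<close>

text \<open>
  The inverse of \<open>K\<close> pushes Lebesgue measure forward to the measure that gives \<open>{a..b}\<close> the mass
  \<open>K b - K a\<close>. A null set \<open>N\<close> is null for it because its mass is the measure of the Lipschitz image
  \<open>K ` N\<close>. The Radon--Nikodym density is the required \<open>k\<close>. The lower bound on the growth of \<open>K\<close>
  serves to make \<open>K\<close> a bijection.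
\<close>

lemma bilipschitz_increasing_density:
  fixes K :: "real \<Rightarrow> real"
  assumes lower: "\<And>x y. x \<le> y \<Longrightarrow> y - x \<le> K y - K x"
    and upper: "\<And>x y. x \<le> y \<Longrightarrow> K y - K x \<le> B * (y - x)"
  obtains k where "\<And>a b. a \<le> b \<Longrightarrow> (k has_integral (K b - K a)) {a..b}"
proof -
  have K_le: "K x \<le> K y \<longleftrightarrow> x \<le> y" for x y
    using lower[of x y] lower[of y x] by (cases "x \<le> y") auto
  have K_lip: "\<bar>K y - K x\<bar> \<le> B * \<bar>y - x\<bar>" for x y
    using upper[of x y] upper[of y x] K_le[of x y] K_le[of y x] by (cases "x \<le> y") auto
  have "B-lipschitz_on UNIV K"
    using K_lip upper[of 0 1] lower[of 0 1] by (intro lipschitz_onI) (auto simp: dist_real_def)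
  then have contK: "continuous_on S K" for S
    using lipschitz_on_continuous_on continuous_on_subset by blast
  have "\<exists>x. K x = y" for y
  proof -
    define M where "M = \<bar>y - K 0\<bar>"
    have "K (-M) \<le> y" "y \<le> K M" "-M \<le> M"
      using lower[of "-M" 0] lower[of 0 M] unfolding M_def by auto
    then show ?thesis
      using IVT'[of K "-M" y M] contK by blast
  qed
  then have surj: "surj K" by (metis surjI)
  have inj: "inj K" using K_le by (metis antisym injI order_refl)
  define T where "T = inv K"
  have KT: "K (T y) = y" and TK: "T (K x) = x" for x y
    using surj inj by (auto simp: T_def surj_f_inv_f)
  have "mono T"
    by (rule monoI) (metis KT K_le)
  then have [measurable]: "T \<in> borel_measurable borel"
    by (rule borel_measurable_mono)
  define \<mu> where "\<mu> = distr lborel borel T"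
  have vim: "T -` A = K ` A" for A
    using KT TK by (auto simp: image_iff) metis
  have \<mu>: "emeasure \<mu> A = emeasure lborel (K ` A)" if "A \<in> sets borel" for A
    using that by (simp add: \<mu>_def emeasure_distr flip: vim)
  have \<mu>_int: "emeasure \<mu> {a..b} = ennreal (K b - K a)" if "a \<le> b" for a b
  proof -
    have "K ` {a..b} = {K a..K b}"
      by (rule set_eqI) (metis K_le KT image_iff atLeastAtMost_iff)
    then show ?thesis using \<mu>[of "{a..b}"] that K_le by simp
  qed
  have ac: "absolutely_continuous lborel \<mu>"
    unfolding absolutely_continuous_def
  proof
    fix N :: "real set" assume N: "N \<in> null_sets lborel"
    then have Nb: "N \<in> sets borel" by auto
    have "negligible N"
      using N by (simp add: negligible_iff_null_sets null_sets_completionI)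
    then have "negligible (K ` N)"
      using K_lip by (intro negligible_locally_Lipschitz_image) (auto intro!: exI[of _ UNIV] exI[of _ B])
    then have "T -` N \<in> null_sets lebesgue"
      by (simp add: negligible_iff_null_sets vim)
    moreover have "T -` N \<in> sets borel"
      using measurable_sets[of T borel borel N] Nb by simp
    ultimately have "emeasure lborel (K ` N) = 0"
      by (auto simp: null_sets_completion_iff vim)
    then show "N \<in> null_sets \<mu>"
      using Nb \<mu> by (auto simp: null_sets_def \<mu>_def)
  qed
  obtain f where [measurable]: "f \<in> borel_measurable lborel" and f: "density lborel f = \<mu>"
    using sigma_finite_measure.Radon_Nikodym[OF sigma_finite_lborel ac] by (auto simp: \<mu>_def)
  have nn: "(\<integral>\<^sup>+x. f x * indicator {a..b} x \<partial>lborel) = ennreal (K b - K a)" if "a \<le> b" for a b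
    using \<mu>_int[OF that] by (simp add: emeasure_density flip: f)
  have "AE x in lborel. \<forall>n::nat. f x * indicator {- real n..real n} x \<noteq> \<infinity>"
    unfolding AE_all_countable
    using nn by (intro allI nn_integral_PInf_AE) auto
  then have fin: "AE x in lborel. f x \<noteq> \<infinity>"
  proof eventually_elim
    case (elim x)
    obtain n where "\<bar>x\<bar> \<le> real n" using real_arch_simple by blast
    then have "x \<in> {- real n..real n}" by auto
    then show ?case using elim[rule_format, of n] by simp
  qed
  define k where "k x = enn2real (f x)" for x
  have "(k has_integral (K b - K a)) {a..b}" if "a \<le> b" for a b
  proof -
    have "(\<integral>\<^sup>+x. ennreal (k x * indicator {a..b} x) \<partial>lborel) = (\<integral>\<^sup>+x. f x * indicator {a..b} x \<partial>lborel)"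
    proof (rule nn_integral_cong_AE, use fin in eventually_elim)
      case (elim x)
      then show ?case by (auto simp: k_def indicator_def ennreal_enn2real_if)
    qed
    then have "((\<lambda>x. k x * indicator {a..b} x) has_integral (K b - K a)) UNIV"
      using nn[OF that] that K_le
      by (intro nn_integral_has_integral) (auto simp: k_def)
    moreover have "(\<lambda>x. k x * indicator {a..b} x) = (\<lambda>x. if x \<in> {a..b} then k x else 0)"
      by (auto simp: indicator_def)
    ultimately show ?thesis
      using has_integral_restrict_UNIV[of "{a..b}" k "K b - K a"] by simp
  qed
  then show thesis by (rule that)
qed

text \<open>
  The Lebesgue differentiation theorem \<open>integrable_ccontinuous_explicit\<close> speaks of the intervals to the
  right of a point only; applied to the reflected density it gives the derivative from the left, with
  the same value.
\<close>

lemma indefinite_integral_differentiable_ae: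
  fixes K k :: "real \<Rightarrow> real"
  assumes k: "\<And>a b. a \<le> b \<Longrightarrow> (k has_integral (K b - K a)) {a..b}"
  shows "negligible {x. \<not> K differentiable (at x)}"
proof -
  have "k integrable_on cbox a b" for a b
    using k[of a b] by (cases "a \<le> b") (auto simp: integrable_on_def)
  then obtain N where N: "negligible N" and
    Nd: "\<And>x e. \<lbrakk>x \<notin> N; 0 < e\<rbrakk> \<Longrightarrow> \<exists>d>0. \<forall>h. 0 < h \<and> h < d \<longrightarrow>
           norm (integral (cbox x (x + h *\<^sub>R One)) k /\<^sub>R h ^ DIM(real) - k x) < e"
    using integrable_ccontinuous_explicit by blast
  \<comment> \<open>Intervals to the right of \<open>- x\<close> for the reflected density are intervals to the left of \<open>x\<close>.\<close>
  have kr: "((\<lambda>t. k (- t)) has_integral (K (-a) - K (-b))) {a..b}" if "a \<le> b" for a b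
    using has_integral_reflect_lemma_real[OF k[of "-b" "-a"]] that by simp
  have "(\<lambda>t. k (- t)) integrable_on cbox a b" for a b
    using kr[of a b] by (cases "a \<le> b") (auto simp: integrable_on_def)
  then obtain N' where N': "negligible N'" and
    Nd': "\<And>x e. \<lbrakk>x \<notin> N'; 0 < e\<rbrakk> \<Longrightarrow> \<exists>d>0. \<forall>h. 0 < h \<and> h < d \<longrightarrow>
           norm (integral (cbox x (x + h *\<^sub>R One)) (\<lambda>t. k (- t)) /\<^sub>R h ^ DIM(real) - k (- x)) < e"
    using integrable_ccontinuous_explicit[of "\<lambda>t. k (- t)"] by blast
  have "(K has_real_derivative k x) (at x)" if x: "x \<notin> N" "- x \<notin> N'" for x
    unfolding DERIV_def LIM_def
  proof (intro allI impI)
    fix e :: real assume "e > 0"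
    obtain d where d: "d > 0" "\<And>h. 0 < h \<Longrightarrow> h < d \<Longrightarrow>
        norm (integral (cbox x (x + h *\<^sub>R One)) k /\<^sub>R h ^ DIM(real) - k x) < e"
      using Nd[OF x(1) \<open>e > 0\<close>] by blast
    obtain d' where d': "d' > 0" "\<And>h. 0 < h \<Longrightarrow> h < d' \<Longrightarrow>
        norm (integral (cbox (-x) (-x + h *\<^sub>R One)) (\<lambda>t. k (- t)) /\<^sub>R h ^ DIM(real) - k (- (-x))) < e"
      using Nd'[OF x(2) \<open>e > 0\<close>] by blast
    have "dist ((K (x + h) - K x) / h) (k x) < e" if h: "h \<noteq> 0" "\<bar>h\<bar> < min d d'" for h
    proof (cases "h > 0")
      case True
      then show ?thesis
        using d(2)[of h] h integral_unique[OF k[of x "x + h"]]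
        by (simp add: dist_real_def divide_inverse mult.commute)
    next
      case False
      then have "h < 0" using h by simp
      moreover have "integral {-x..-x + -h} (\<lambda>t. k (- t)) = K x - K (x + h)"
        using integral_unique[OF kr[of "-x" "-x + -h"]] \<open>h < 0\<close> by (simp add: add.commute)
      moreover have "(K x - K (x + h)) / (-h) = (K (x + h) - K x) / h"
        by (metis minus_diff_eq minus_divide_divide)
      ultimately show ?thesis
        using d'(2)[of "-h"] h by (simp add: dist_real_def divide_inverse mult.commute)
    qed
    then show "\<exists>s>0. \<forall>h. h \<noteq> 0 \<and> dist h 0 < s \<longrightarrow> dist ((K (x + h) - K x) / h) (k x) < e"
      using d(1) d'(1) by (intro exI[of _ "min d d'"]) auto
  qed
  then have "{x. \<not> K differentiable (at x)} \<subseteq> N \<union> uminus ` N'"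
    using real_differentiable_def by (auto simp: image_iff) (metis minus_minus)
  moreover have "negligible (uminus ` N')"
    by (rule negligible_locally_Lipschitz_image[OF _ N'])
      (auto intro!: exI[of _ "UNIV :: real set"] exI[of _ "1 :: real"])
  ultimately show ?thesis
    using N negligible_Un negligible_subset by blast
qed

text \<open>
  Adding \<open>(C + 1) * x\<close> to a \<open>C\<close>-Lipschitz function makes it increase at least at unit speed, hence
  an indefinite integral.
\<close>

lemma lipschitz_real_differentiable_ae:
  fixes g :: "real \<Rightarrow> real"
  assumes "C-lipschitz_on UNIV g"
  shows "negligible {x. \<not> g differentiable (at x)}"
proof -
  define K where "K x = g x + (C + 1) * x" for x
  have g: "\<bar>g y - g x\<bar> \<le> C * (y - x)" if "x \<le> y" for x y
    using lipschitz_onD[OF assms, of y x] that by (auto simp: dist_real_def)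
  have "y - x \<le> K y - K x" "K y - K x \<le> (2 * C + 1) * (y - x)" if "x \<le> y" for x y
    using g[OF that] by (auto simp: K_def algebra_simps abs_le_iff)
  then obtain k where "\<And>a b. a \<le> b \<Longrightarrow> (k has_integral (K b - K a)) {a..b}"
    using bilipschitz_increasing_density[of K "2 * C + 1"] by blast
  then have "negligible {x. \<not> K differentiable (at x)}"
    by (rule indefinite_integral_differentiable_ae)
  moreover have "g differentiable (at x)" if "K differentiable (at x)" for x
  proof -
    have "g = (\<lambda>x. K x - (C + 1) * x)" by (auto simp: K_def)
    then show ?thesis using that by (auto intro!: derivative_intros)
  qed
  ultimately show ?thesis
    by (elim negligible_subset) blast
qed

lemma lipschitz_complex_vector_derivative_ae:
  fixes g :: "real \<Rightarrow> complex"
  assumes lip: "C-lipschitz_on UNIV g"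
  shows "negligible {x. \<nexists>A. (g has_vector_derivative A) (at x)}"
proof -
  have "C-lipschitz_on UNIV (\<lambda>x. Re (g x))" "C-lipschitz_on UNIV (\<lambda>x. Im (g x))"
    using lip abs_Re_le_cmod abs_Im_le_cmod unfolding lipschitz_on_def dist_norm real_norm_def
    by (metis minus_complex.simps order_trans)+
  then have "negligible ({x. \<not> (\<lambda>x. Re (g x)) differentiable (at x)} \<union> {x. \<not> (\<lambda>x. Im (g x)) differentiable (at x)})"
    by (intro negligible_Un lipschitz_real_differentiable_ae)
  moreover have "\<exists>A. (g has_vector_derivative A) (at x)"
    if R: "(\<lambda>x. Re (g x)) differentiable (at x)" and I: "(\<lambda>x. Im (g x)) differentiable (at x)" for x
  proof -
    obtain a b where ab: "((\<lambda>x. Re (g x)) has_vector_derivative a) (at x)" "((\<lambda>x. Im (g x)) has_vector_derivative b) (at x)"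
      using R I by (auto simp: real_differentiable_def has_real_derivative_iff_has_vector_derivative)
    have "(g has_vector_derivative Complex a b) (at x)"
      using has_vector_derivative_complex_iff[of g "Complex a b" "at x"] ab
      by (simp add: has_real_derivative_iff_has_vector_derivative)
    then show ?thesis by blast
  qed
  ultimately show ?thesis
    by (elim negligible_subset) blast
qed

section \<open>Radial limits of bounded holomorphic functions in the disc\<close>

text \<open>
  A derivative along the circle gives the first-order expansion of \<open>H\<close> in the variable \<open>w\<close>: on the
  circle, \<open>- \<i> * (w - 1)\<close> and the angle \<open>Im (Ln w)\<close> agree up to second order.
\<close>

lemma circle_first_order:
  fixes H :: "complex \<Rightarrow> complex"
  assumes "((\<lambda>t. H (cis t)) has_vector_derivative A) (at 0)" and "e > 0"
  shows "\<exists>\<delta>>0. \<forall>w. cmod w = 1 \<and> cmod (w - 1) < \<delta> \<longrightarrow>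
           cmod (H w - H 1 - (- \<i> * A) * (w - 1)) \<le> e * cmod (w - 1)"
proof -
  have L: "((\<lambda>w. Im (Ln w)) has_derivative (\<lambda>v. Im v)) (at 1)"
  proof -
    have "(Ln has_derivative (\<lambda>v. v)) (at 1)"
      using has_field_derivative_Ln[of 1] by (simp add: has_field_derivative_def lambda_one)
    then show ?thesis
      by (rule has_derivative_Im)
  qed
  have "((\<lambda>t. H (cis t)) has_derivative (\<lambda>h. h *\<^sub>R A)) (at (Im (Ln 1)))"
    using assms(1) by (simp add: has_vector_derivative_def)
  from has_derivative_compose[OF L this]
  have "((\<lambda>w. H (cis (Im (Ln w)))) has_derivative (\<lambda>v. Im v *\<^sub>R A)) (at 1)" .
  then obtain d where d: "d > 0" "\<And>w. cmod (w - 1) < d \<Longrightarrow>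
      cmod (H (cis (Im (Ln w))) - H (cis (Im (Ln 1))) - Im (w - 1) *\<^sub>R A) \<le> (e / 2) * cmod (w - 1)"
    using \<open>e > 0\<close> unfolding has_derivative_at_alt by (meson half_gt_zero)
  define \<delta> where "\<delta> = min d (e / (cmod A + 1))"
  have "cmod (H w - H 1 - (- \<i> * A) * (w - 1)) \<le> e * cmod (w - 1)"
    if w: "cmod w = 1" "cmod (w - 1) < \<delta>" for w
  proof -
    have "w \<noteq> 0" using w by auto
    then have "Ln w = \<i> * Im (Ln w)"
      using w(1) by (simp add: complex_eq_iff)
    then have "cis (Im (Ln w)) = w"
      using \<open>w \<noteq> 0\<close> by (metis cis_conv_exp exp_Ln)
    then have 1: "cmod (H w - H 1 - Im (w - 1) *\<^sub>R A) \<le> (e / 2) * cmod (w - 1)"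
      using d(2)[of w] w(2) by (simp add: \<delta>_def)
    \<comment> \<open>The real part of \<open>w - 1\<close> is of second order on the unit circle.\<close>
    have sq: "(cmod (w - 1))\<^sup>2 = - 2 * Re (w - 1)"
      using w(1) cmod_power2[of w] cmod_power2[of "w - 1"] by (simp add: power2_eq_square algebra_simps)
    have "Im (w - 1) *\<^sub>R A - (- \<i> * A) * (w - 1) = \<i> * A * Re (w - 1)"
      by (simp add: complex_eq_iff algebra_simps)
    also have "cmod \<dots> = cmod A * \<bar>Re (w - 1)\<bar>" by (simp only: norm_mult norm_of_real norm_ii mult_1)
    also have "\<bar>Re (w - 1)\<bar> = (cmod (w - 1))\<^sup>2 / 2"
      using sq zero_le_power2[of "cmod (w - 1)"] by linarith
    also have "cmod A * ((cmod (w - 1))\<^sup>2 / 2) = (cmod A * cmod (w - 1)) * (cmod (w - 1) / 2)"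
      by (simp add: power2_eq_square)
    also have "\<dots> \<le> e * (cmod (w - 1) / 2)"
    proof (rule mult_right_mono)
      have "cmod A * cmod (w - 1) \<le> (cmod A + 1) * cmod (w - 1)"
        by (simp add: mult_right_mono)
      also have "\<dots> \<le> e"
        using w(2) pos_less_divide_eq[of "cmod A + 1" "cmod (w - 1)" e]
        by (simp add: \<delta>_def add_nonneg_pos mult.commute)
      finally show "cmod A * cmod (w - 1) \<le> e" .
    qed simp
    finally have 2: "cmod (Im (w - 1) *\<^sub>R A - (- \<i> * A) * (w - 1)) \<le> e * (cmod (w - 1) / 2)" .
    have split: "H w - H 1 - (- \<i> * A) * (w - 1) =
        (H w - H 1 - Im (w - 1) *\<^sub>R A) + (Im (w - 1) *\<^sub>R A - (- \<i> * A) * (w - 1))"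
      by simp
    show ?thesis
      unfolding split using norm_triangle_mono[OF 1 2] by linarith
  qed
  moreover have "\<delta> > 0" using d(1) \<open>e > 0\<close> by (simp add: \<delta>_def add_nonneg_pos)
  ultimately show ?thesis by blast
qed

text \<open>
  A form of the Phragmen--Lindelof principle: near \<open>1\<close>, a bound by \<open>e * cmod (w - 1)\<close> on the circle
  persists inside the disc, up to the factor \<open>2\<close>, given a bound by \<open>C * cmod (w - 1)\<close> everywhere. The
  maximum principle is applied on \<open>U\<close>, the part of the disc within distance \<open>\<delta>\<close> of \<open>1\<close>. On the inner
  boundary arc only the bound with \<open>C\<close> is available, and the factor \<open>exp (- L * (1 - w))\<close> compensates
  for it: by strict convexity of the disc, the real part of \<open>1 - w\<close> is at least \<open>\<delta>\<^sup>2 / 2\<close> there,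
  although it vanishes at \<open>1\<close>. The division by \<open>w - 1\<close> is made harmless by moving the pole to
  \<open>1 + \<kappa>\<close>, outside the closed disc, and letting \<open>\<kappa>\<close> tend to zero at the end.
\<close>

lemma small_on_arc_imp_small_inside:
  fixes H :: "complex \<Rightarrow> complex"
  assumes hol: "H holomorphic_on ball 0 1" and cont: "continuous_on (cball 0 1) H"
    and C: "\<And>w. w \<in> cball 0 1 \<Longrightarrow> cmod (H w) \<le> C * cmod (w - 1)"
    and e: "e > 0" and \<delta>: "\<delta> > 0"
    and arc: "\<And>w. cmod w = 1 \<Longrightarrow> cmod (w - 1) < \<delta> \<Longrightarrow> cmod (H w) \<le> e * cmod (w - 1)"
  shows "\<exists>\<eta>>0. \<forall>w\<in>ball 0 1. cmod (w - 1) < \<eta> \<longrightarrow> cmod (H w) \<le> 2 * e * cmod (w - 1)"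
proof -
  define U where "U = ball 0 1 \<inter> ball (1::complex) \<delta>"
  obtain L where L: "L > 0" "C * exp (- L * (\<delta>\<^sup>2 / 2)) \<le> e"
  proof -
    \<comment> \<open>The maximum keeps the argument of the logarithm positive.\<close>
    define D where "D = max C e"
    have "D > 0" "C \<le> D" using e by (auto simp: D_def)
    define L where "L = max 1 (ln (D / e) / (\<delta>\<^sup>2 / 2))"
    have "ln (D / e) \<le> L * (\<delta>\<^sup>2 / 2)"
      using \<delta> by (simp add: L_def field_simps max_def)
    then have "D / e \<le> exp (L * (\<delta>\<^sup>2 / 2))"
      using \<open>D > 0\<close> e by (metis divide_pos_pos exp_le_cancel_iff exp_ln)
    then have "D * exp (- (L * (\<delta>\<^sup>2 / 2))) \<le> e"
      using e by (simp add: exp_minus field_simps)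
    moreover have "C * exp (- (L * (\<delta>\<^sup>2 / 2))) \<le> D * exp (- (L * (\<delta>\<^sup>2 / 2)))"
      using \<open>C \<le> D\<close> by simp
    ultimately have "C * exp (- (L * (\<delta>\<^sup>2 / 2))) \<le> e" by (rule order_trans[rotated])
    then have "C * exp (- L * (\<delta>\<^sup>2 / 2)) \<le> e" by simp
    then show thesis by (intro that[of L]) (auto simp: L_def)
  qed
  have Re_ge: "(cmod (w - 1))\<^sup>2 / 2 \<le> Re (1 - w)" if "cmod w \<le> 1" for w
  proof -
    have "(cmod w)\<^sup>2 \<le> 1" using that by (simp add: power_le_one)
    then show ?thesis
      using cmod_power2[of w] cmod_power2[of "w - 1"] by (simp add: power2_eq_square algebra_simps)
  qed
  have shifted: "cmod (H w) * exp (- L * Re (1 - w)) \<le> e * cmod (w - of_real (1 + \<kappa>))"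
    if w: "w \<in> U" and \<kappa>: "\<kappa> > 0" for w \<kappa>
  proof -
    have far: "cmod (w - 1) \<le> cmod (w - of_real (1 + \<kappa>))" "w \<noteq> of_real (1 + \<kappa>)" if "cmod w \<le> 1" for w
    proof -
      have "Re w \<le> 1" using that complex_Re_le_cmod[of w] by linarith
      then have "(Re w - 1)\<^sup>2 \<le> (Re w - (1 + \<kappa>))\<^sup>2"
        using \<kappa> by (intro abs_le_square_iff[THEN iffD1]) auto
      then have "(cmod (w - 1))\<^sup>2 \<le> (cmod (w - of_real (1 + \<kappa>)))\<^sup>2"
        by (simp add: cmod_power2)
      then show "cmod (w - 1) \<le> cmod (w - of_real (1 + \<kappa>))"
        by (rule power2_le_imp_le) simp
      show "w \<noteq> of_real (1 + \<kappa>)" using \<open>Re w \<le> 1\<close> \<kappa> by auto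
    qed
    define E where "E w = H w * exp (- of_real L * (1 - w)) / (w - of_real (1 + \<kappa>))" for w
    have sub: "closure U \<subseteq> cball 0 1 \<inter> cball 1 \<delta>"
      unfolding U_def by (rule closure_minimal) auto
    have "open U" by (auto simp: U_def)
    have normE: "cmod (E w) = cmod (H w) * exp (- L * Re (1 - w)) / cmod (w - of_real (1 + \<kappa>))" for w
      by (simp add: E_def norm_mult norm_divide)
    have "cmod (E w) \<le> e"
    proof (rule maximum_modulus_frontier[of E U])
      show "E holomorphic_on interior U"
        using far(2) unfolding E_def interior_open[OF \<open>open U\<close>]
        by (auto intro!: holomorphic_intros holomorphic_on_subset[OF hol] simp: U_def)
      show "continuous_on (closure U) E"
        using far(2) sub unfolding E_def
        by (fastforce intro!: continuous_intros continuous_on_subset[OF cont])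
      show "bounded U" by (auto simp: U_def)
    next
      fix z assume "z \<in> frontier U"
      then have "z \<in> closure U" "z \<notin> U"
        using \<open>open U\<close> by (auto simp: frontier_def interior_open)
      then have z: "cmod z \<le> 1" "cmod (z - 1) \<le> \<delta>" "cmod z = 1 \<or> cmod (z - 1) = \<delta>"
        using sub by (auto simp: U_def dist_norm norm_minus_commute)
      have Rz: "Re (1 - z) \<ge> (cmod (z - 1))\<^sup>2 / 2" by (rule Re_ge[OF z(1)])
      then have "Re (1 - z) \<ge> 0" using zero_le_power2[of "cmod (z - 1)"] by linarith
      have "cmod (H z) * exp (- L * Re (1 - z)) \<le> e * cmod (z - 1)"
      proof (cases "cmod (z - 1) = \<delta>")
        case True
        have "cmod (H z) * exp (- L * Re (1 - z)) \<le> (C * cmod (z - 1)) * exp (- L * Re (1 - z))"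
          using C[of z] z(1) by (intro mult_right_mono) auto
        also have "\<dots> \<le> (C * cmod (z - 1)) * exp (- L * (\<delta>\<^sup>2 / 2))"
        proof (intro mult_left_mono)
          show "exp (- L * Re (1 - z)) \<le> exp (- L * (\<delta>\<^sup>2 / 2))"
            using Rz True L(1) by auto
          show "0 \<le> C * cmod (z - 1)"
            using order_trans[OF norm_ge_zero C[of z]] z(1) by simp
        qed
        also have "\<dots> = (C * exp (- L * (\<delta>\<^sup>2 / 2))) * cmod (z - 1)" by simp
        also have "\<dots> \<le> e * cmod (z - 1)"
          using L(2) by (intro mult_right_mono) auto
        finally show ?thesis .
      next
        case False
        then have "cmod (H z) \<le> e * cmod (z - 1)" using z arc by auto
        moreover have "exp (- L * Re (1 - z)) \<le> 1"
          using L(1) \<open>Re (1 - z) \<ge> 0\<close> by simp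
        ultimately have "cmod (H z) * exp (- L * Re (1 - z)) \<le> (e * cmod (z - 1)) * 1"
          using e by (intro mult_mono) auto
        then show ?thesis by simp
      qed
      also have "\<dots> \<le> e * cmod (z - of_real (1 + \<kappa>))"
        using far(1)[OF z(1)] e by simp
      finally show "cmod (E z) \<le> e"
        using far(2)[OF z(1)] by (simp add: normE field_simps)
    qed (rule w)
    then show ?thesis
      using far(2)[of w] w by (simp add: normE field_simps U_def)
  qed
  have bound: "cmod (H w) * exp (- L * Re (1 - w)) \<le> e * cmod (w - 1)" if w: "w \<in> U" for w
  proof (rule tendsto_lowerbound)
    show "((\<lambda>\<kappa>. e * cmod (w - of_real (1 + \<kappa>))) \<longlongrightarrow> e * cmod (w - 1)) (at_right 0)"
      by (auto intro!: tendsto_eq_intros)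
    show "\<forall>\<^sub>F \<kappa> in at_right 0. cmod (H w) * exp (- L * Re (1 - w)) \<le> e * cmod (w - of_real (1 + \<kappa>))"
      using shifted[OF w] by (auto simp: eventually_at_filter)
  qed simp
  define \<eta> where "\<eta> = min \<delta> (ln 2 / L)"
  have "cmod (H w) \<le> 2 * e * cmod (w - 1)" if w: "w \<in> ball 0 1" "cmod (w - 1) < \<eta>" for w
  proof -
    have "Re (1 - w) \<le> cmod (w - 1)"
      using complex_Re_le_cmod[of "1 - w"] by (simp add: norm_minus_commute)
    also have "\<dots> \<le> ln 2 / L" using w(2) by (simp add: \<eta>_def)
    finally have "L * Re (1 - w) \<le> ln 2" using L(1) by (simp add: field_simps)
    then have "exp (L * Re (1 - w)) \<le> 2"
      by (metis exp_le_cancel_iff exp_ln zero_less_numeral)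
    moreover have "cmod (H w) \<le> e * cmod (w - 1) * exp (L * Re (1 - w))"
    proof -
      have "w \<in> U" using w by (simp add: U_def \<eta>_def dist_norm norm_minus_commute)
      from mult_right_mono[OF bound[OF this], of "exp (L * Re (1 - w))"] show ?thesis
        by (simp add: mult.assoc flip: exp_add)
    qed
    ultimately show ?thesis
      using order_trans[OF _ mult_left_mono[of "exp (L * Re (1 - w))" 2 "e * cmod (w - 1)"]] e
      by (simp add: mult_ac del: mult_le_cancel_left_pos)
  qed
  moreover have "\<eta> > 0" using \<delta> L by (simp add: \<eta>_def)
  ultimately show ?thesis by blast
qed

text \<open>
  Subtracting the first-order expansion at \<open>1\<close> leaves a remainder \<open>R\<close> which is \<open>o(cmod (w - 1))\<close> on
  the circle, hence inside the disc as well. Cauchy's estimate on the disc about \<open>s\<close> of radius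
  \<open>(1 - s) / 2\<close> then shows that the derivative of \<open>R\<close> at \<open>s\<close> tends to zero.
\<close>

lemma radial_limit_of_derivative:
  fixes H :: "complex \<Rightarrow> complex"
  assumes hol: "H holomorphic_on ball 0 1" and lip: "C-lipschitz_on (cball 0 1) H"
    and der: "((\<lambda>t. H (cis t)) has_vector_derivative A) (at 0)"
  shows "((\<lambda>s. deriv H (of_real s)) \<longlongrightarrow> - \<i> * A) (at_left 1)"
proof -
  define a where "a = - \<i> * A"
  define R where "R w = H w - H 1 - a * (w - 1)" for w
  have holR: "R holomorphic_on ball 0 1"
    unfolding R_def by (intro holomorphic_intros hol)
  have contR: "continuous_on (cball 0 1) R"
    unfolding R_def by (intro continuous_intros lipschitz_on_continuous_on[OF lip])
  have R_le: "cmod (R w) \<le> (C + cmod a) * cmod (w - 1)" if "w \<in> cball 0 1" for w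
  proof -
    have "cmod (H w - H 1) \<le> C * cmod (w - 1)"
      using lipschitz_onD[OF lip that, of 1] by (simp add: dist_norm)
    moreover have "cmod (R w) \<le> cmod (H w - H 1) + cmod a * cmod (w - 1)"
      unfolding R_def by (metis norm_mult norm_triangle_ineq4)
    ultimately show ?thesis by (simp add: algebra_simps)
  qed
  have "\<forall>\<^sub>F s in at_left 1. dist (deriv H (of_real s)) a < e" if "e > 0" for e
  proof -
    \<comment> \<open>Cauchy's estimate below loses the factor \<open>6\<close>.\<close>
    have e7: "e / 7 > 0" using that by simp
    obtain \<delta> where "\<delta> > 0" "\<And>w. cmod w = 1 \<Longrightarrow> cmod (w - 1) < \<delta> \<Longrightarrow> cmod (R w) \<le> e / 7 * cmod (w - 1)"
      using circle_first_order[OF der e7] unfolding R_def a_def by blast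
    with small_on_arc_imp_small_inside[OF holR contR R_le e7]
    obtain \<eta> where \<eta>: "\<eta> > 0" "\<And>w. w \<in> ball 0 1 \<Longrightarrow> cmod (w - 1) < \<eta> \<Longrightarrow> cmod (R w) \<le> 2 * (e / 7) * cmod (w - 1)"
      by blast
    have "dist (deriv H (of_real s)) a < e" if s: "max 0 (1 - \<eta> / 2) < s" "s < 1" for s
    proof -
      define \<rho> where "\<rho> = (1 - s) / 2"
      have \<rho>: "\<rho> > 0" "s + \<rho> < 1" "3 * \<rho> < \<eta>" using s by (auto simp: \<rho>_def field_simps)
      have near: "w \<in> ball 0 1 \<and> cmod (w - 1) \<le> 3 * \<rho>" if "w \<in> cball (of_real s) \<rho>" for w :: complex
      proof -
        have d: "cmod (w - of_real s) \<le> \<rho>" using that by (simp add: dist_norm norm_minus_commute)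
        have "cmod w \<le> cmod (w - of_real s) + cmod (of_real s :: complex)"
          by (metis diff_add_cancel norm_triangle_ineq)
        moreover have "cmod (w - 1) \<le> cmod (w - of_real s) + cmod (of_real s - 1 :: complex)"
          by (metis diff_add_cancel add_diff_eq norm_triangle_ineq)
        moreover have "cmod (of_real s - 1 :: complex) = 1 - s"
          using s by (metis abs_minus_commute abs_of_pos diff_gt_0_iff_gt norm_of_real of_real_1 of_real_diff)
        ultimately show ?thesis using d \<rho> s by (auto simp: \<rho>_def)
      qed
      have "cmod ((deriv ^^ 1) R (of_real s)) \<le> fact 1 * (2 * (e / 7) * (3 * \<rho>)) / \<rho> ^ 1"
      proof (rule Cauchy_inequality)
        show "R holomorphic_on ball (of_real s) \<rho>"
          using near by (intro holomorphic_on_subset[OF holR]) (auto simp: subset_iff)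
        show "continuous_on (cball (of_real s) \<rho>) R"
          using near by (intro continuous_on_subset[OF contR] subsetI) (metis ball_subset_cball subsetD)
        show "cmod (R w) \<le> 2 * (e / 7) * (3 * \<rho>)" if "cmod (of_real s - w) = \<rho>" for w
        proof -
          have "w \<in> cball (of_real s) \<rho>" using that by (simp add: dist_norm)
          then have "cmod (R w) \<le> 2 * (e / 7) * cmod (w - 1)" and "cmod (w - 1) \<le> 3 * \<rho>"
            using near[of w] \<eta>(2)[of w] \<rho>(3) by auto
          moreover have "2 * (e / 7) * cmod (w - 1) \<le> 2 * (e / 7) * (3 * \<rho>)"
            using calculation(2) \<open>e > 0\<close> by (intro mult_left_mono) auto
          ultimately show ?thesis by (meson order_trans)
        qed
      qed (rule \<rho>(1))
      then have "cmod (deriv R (of_real s)) \<le> 6 * e / 7" using \<rho>(1) by simp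
      moreover have "deriv R (of_real s) = deriv H (of_real s) - a"
      proof (rule DERIV_imp_deriv)
        have "(of_real s :: complex) \<in> ball 0 1" using s by simp
        then have "(H has_field_derivative deriv H (of_real s)) (at (of_real s))"
          using holomorphic_derivI[OF hol] by auto
        then show "(R has_field_derivative deriv H (of_real s) - a) (at (of_real s))"
          unfolding R_def by (auto intro!: derivative_eq_intros)
      qed
      ultimately show ?thesis using \<open>e > 0\<close> by (simp add: dist_norm)
    qed
    moreover have "max 0 (1 - \<eta> / 2) < 1" using \<eta>(1) by simp
    ultimately show ?thesis
      unfolding eventually_at_left_field by blast
  qed
  then show ?thesis unfolding a_def[symmetric] by (simp add: tendsto_iff)
qed

text \<open>
  Fatou's theorem. A primitive \<open>H\<close> of the bounded function \<open>F\<close> is Lipschitz, hence extends to a Lipschitz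
  function on the closed disc. Its restriction to the circle is differentiable at almost every angle,
  and at each such angle the derivative \<open>F\<close> of \<open>H\<close> has a radial limit.
\<close>

theorem Fatou_radial_limits:
  fixes F :: "complex \<Rightarrow> complex"
  assumes hol: "F holomorphic_on ball 0 1" and le: "\<And>w. w \<in> ball 0 1 \<Longrightarrow> cmod (F w) \<le> 1"
  shows "negligible {\<theta>. \<nexists>l. ((\<lambda>s. F (of_real s * cis \<theta>)) \<longlongrightarrow> l) (at_left 1)}"
proof -
  obtain H0 where H0_within: "\<And>w. w \<in> ball 0 1 \<Longrightarrow> (H0 has_field_derivative F w) (at w within ball 0 1)"
    using holomorphic_convex_primitive'[OF convex_ball open_ball hol] by auto
  have H0: "(H0 has_field_derivative F w) (at w)" if "w \<in> ball 0 1" for w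
    using H0_within[OF that] unfolding at_within_open[OF that open_ball] .
  have "1-lipschitz_on (ball 0 1) H0"
  proof (rule lipschitz_onI)
    fix x y :: complex assume xy: "x \<in> ball 0 1" "y \<in> ball 0 1"
    have "cmod (H0 x - H0 y) \<le> 1 * cmod (x - y)"
    proof (rule field_differentiable_bound[OF convex_ball _ _ xy])
      show "(H0 has_field_derivative F w) (at w within ball 0 1)" if "w \<in> ball 0 1" for w
        by (rule has_field_derivative_at_within[OF H0[OF that]])
    qed (rule le)
    then show "dist (H0 x) (H0 y) \<le> 1 * dist x y"
      by (simp add: dist_norm)
  qed simp
  then obtain H where H: "1-lipschitz_on (cball 0 1) H" and eq: "\<And>w. w \<in> ball 0 1 \<Longrightarrow> H w = H0 w"
    using lipschitz_extend_closure[of 1 "ball 0 1" H0] unfolding closure_ball[OF zero_less_one] by blast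
  have Hd: "(H has_field_derivative F w) (at w)" if "w \<in> ball 0 1" for w
    by (rule has_field_derivative_transform_within_open[OF H0[OF that] open_ball that]) (rule eq[symmetric])
  have "1-lipschitz_on UNIV (\<lambda>t. H (cis t))"
  proof (rule lipschitz_onI)
    fix x y :: real
    have "dist (H (cis x)) (H (cis y)) \<le> 1 * dist (cis x) (cis y)"
      by (rule lipschitz_onD[OF H]) auto
    also have "dist (cis x) (cis y) \<le> dist x y"
    proof -
      have "cmod (cis x - cis y) \<le> 1 * cmod (complex_of_real x - of_real y)"
        unfolding cis_conv_exp
        by (rule field_differentiable_bound[of \<real> _ "\<lambda>z. \<i> * exp (\<i> * z)"])
          (auto simp: norm_mult convex_Reals elim!: Reals_cases intro!: derivative_eq_intros)
      then show ?thesis by (simp add: dist_norm flip: of_real_diff)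
    qed
    finally show "dist (H (cis x)) (H (cis y)) \<le> 1 * dist x y" by simp
  qed simp
  then have "negligible {\<theta>. \<nexists>A. ((\<lambda>t. H (cis t)) has_vector_derivative A) (at \<theta>)}"
    by (rule lipschitz_complex_vector_derivative_ae)
  moreover have "\<exists>l. ((\<lambda>s. F (of_real s * cis \<theta>)) \<longlongrightarrow> l) (at_left 1)"
    if A: "((\<lambda>t. H (cis t)) has_vector_derivative A) (at \<theta>)" for \<theta> A
  proof -
    define G where "G w = H (cis \<theta> * w)" for w
    have rot: "cis \<theta> * w \<in> ball 0 1 \<longleftrightarrow> w \<in> ball 0 1" for w
      by (simp add: norm_mult)
    have Gd: "(G has_field_derivative cis \<theta> * F (cis \<theta> * w)) (at w)" if "w \<in> ball 0 1" for w
    proof -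
      have "((\<lambda>w. H (cis \<theta> * w)) has_field_derivative F (cis \<theta> * w) * cis \<theta>) (at w)"
      proof (rule DERIV_chain2[OF Hd])
        show "cis \<theta> * w \<in> ball 0 1" using that rot by blast
        show "((*) (cis \<theta>) has_field_derivative cis \<theta>) (at w)"
          by (auto intro!: derivative_eq_intros)
      qed
      then show ?thesis by (simp add: G_def[abs_def] mult.commute)
    qed
    have "((\<lambda>s. deriv G (of_real s)) \<longlongrightarrow> - \<i> * A) (at_left 1)"
    proof (rule radial_limit_of_derivative)
      show "G holomorphic_on ball 0 1"
        unfolding holomorphic_on_def field_differentiable_def
        using Gd has_field_derivative_at_within by blast
      show "1-lipschitz_on (cball 0 1) G"
      proof (rule lipschitz_onI)
        fix x y :: complex assume "x \<in> cball 0 1" "y \<in> cball 0 1"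
        then have "dist (G x) (G y) \<le> 1 * dist (cis \<theta> * x) (cis \<theta> * y)"
          unfolding G_def by (intro lipschitz_onD[OF H]) (auto simp: norm_mult)
        then show "dist (G x) (G y) \<le> 1 * dist x y"
          by (simp add: dist_norm norm_mult flip: right_diff_distrib)
      qed simp
      have "((\<lambda>t. H (cis t)) has_vector_derivative A) (at (\<theta> + 0))" using A by simp
      then have "((\<lambda>t. H (cis t)) \<circ> (\<lambda>t. \<theta> + t) has_vector_derivative 1 *\<^sub>R A) (at 0)"
        by (intro vector_diff_chain_at) (auto intro!: derivative_eq_intros)
      then show "((\<lambda>t. G (cis t)) has_vector_derivative A) (at 0)"
        by (simp add: G_def o_def cis_mult)
    qed
    then have lim: "((\<lambda>s. deriv G (of_real s) / cis \<theta>) \<longlongrightarrow> (- \<i> * A) / cis \<theta>) (at_left 1)"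
      by (intro tendsto_divide tendsto_const) auto
    have "\<forall>\<^sub>F s in at_left 1. deriv G (of_real s) / cis \<theta> = F (of_real s * cis \<theta>)"
      unfolding eventually_at_left_field
      by (intro exI[of _ 0]) (auto simp: DERIV_imp_deriv[OF Gd] mult.commute)
    then have "((\<lambda>s. F (of_real s * cis \<theta>)) \<longlongrightarrow> (- \<i> * A) / cis \<theta>) (at_left 1)"
      by (rule Lim_transform_eventually[OF lim])
    then show ?thesis by blast
  qed
  then have "{\<theta>. \<nexists>l. ((\<lambda>s. F (of_real s * cis \<theta>)) \<longlongrightarrow> l) (at_left 1)} \<subseteq>
      {\<theta>. \<nexists>A. ((\<lambda>t. H (cis t)) has_vector_derivative A) (at \<theta>)}" by blast
  ultimately show ?thesis
    by (rule negligible_subset)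
qed

section \<open>Integration over the torus\<close>

text \<open>
  An integral over the whole space is determined by the integrals over all lines in a fixed direction
  \<open>v\<close>. The indicator selects a slab that meets each such line in a segment of unit parameter length, so
  that averaging over translations in the direction \<open>v\<close> recovers the integral.
\<close>

lemma nn_integral_over_lines:
  fixes F :: "'a::euclidean_space \<Rightarrow> ennreal" and u v :: 'a
  assumes [measurable]: "F \<in> borel_measurable borel" and uv: "v \<bullet> u = 1"
  shows "(\<integral>\<^sup>+x. F x \<partial>lborel) =
    (\<integral>\<^sup>+x. indicator {0..1} (x \<bullet> u) * (\<integral>\<^sup>+t. F (x + t *\<^sub>R v) \<partial>lborel) \<partial>lborel)"
proof -
  define \<psi> :: "real \<Rightarrow> ennreal" where "\<psi> = indicator {0..1}"
  have [measurable]: "\<psi> \<in> borel_measurable borel" by (simp add: \<psi>_def)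
  have shift: "(\<integral>\<^sup>+x. G (x + c) \<partial>lborel) = (\<integral>\<^sup>+x. G x \<partial>lborel)"
    if [measurable]: "G \<in> borel_measurable borel" for G :: "'a \<Rightarrow> ennreal" and c
  proof -
    have "(\<integral>\<^sup>+x. G x \<partial>distr lborel borel ((+) c)) = (\<integral>\<^sup>+x. G (x + c) \<partial>lborel)"
      by (subst nn_integral_distr) (auto simp: add.commute)
    then show ?thesis by (simp add: lborel_distr_plus)
  qed
  have "(\<integral>\<^sup>+x. \<psi> (x \<bullet> u) * (\<integral>\<^sup>+t. F (x + t *\<^sub>R v) \<partial>lborel) \<partial>lborel)
      = (\<integral>\<^sup>+x. (\<integral>\<^sup>+t. \<psi> (x \<bullet> u) * F (x + t *\<^sub>R v) \<partial>lborel) \<partial>lborel)"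
    by (simp add: nn_integral_cmult)
  also have "\<dots> = (\<integral>\<^sup>+t. (\<integral>\<^sup>+x. \<psi> (x \<bullet> u) * F (x + t *\<^sub>R v) \<partial>lborel) \<partial>lborel)"
    by (rule lborel_pair.Fubini'[symmetric]) measurable
  also have "\<dots> = (\<integral>\<^sup>+t. (\<integral>\<^sup>+x. \<psi> (x \<bullet> u - t) * F x \<partial>lborel) \<partial>lborel)"
  proof (rule nn_integral_cong)
    fix t :: real
    have "(\<integral>\<^sup>+x. \<psi> ((x + t *\<^sub>R v) \<bullet> u - t) * F (x + t *\<^sub>R v) \<partial>lborel) = (\<integral>\<^sup>+x. \<psi> (x \<bullet> u - t) * F x \<partial>lborel)"
      by (rule shift[of "\<lambda>x. \<psi> (x \<bullet> u - t) * F x"]) measurable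
    then show "(\<integral>\<^sup>+x. \<psi> (x \<bullet> u) * F (x + t *\<^sub>R v) \<partial>lborel) = (\<integral>\<^sup>+x. \<psi> (x \<bullet> u - t) * F x \<partial>lborel)"
      using uv by (simp add: inner_add_left)
  qed
  also have "\<dots> = (\<integral>\<^sup>+x. (\<integral>\<^sup>+t. \<psi> (x \<bullet> u - t) * F x \<partial>lborel) \<partial>lborel)"
    by (rule lborel_pair.Fubini') measurable
  also have "\<dots> = (\<integral>\<^sup>+x. F x \<partial>lborel)"
  proof (rule nn_integral_cong)
    fix x :: 'a
    have "(\<integral>\<^sup>+t. \<psi> (x \<bullet> u - t) \<partial>lborel) = (\<integral>\<^sup>+t. indicator {x \<bullet> u - 1..x \<bullet> u} t \<partial>(lborel :: real measure))"
      by (intro nn_integral_cong) (auto simp: \<psi>_def indicator_def)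
    also have "\<dots> = 1" by simp
    finally show "(\<integral>\<^sup>+t. \<psi> (x \<bullet> u - t) * F x \<partial>lborel) = F x"
      by (simp add: nn_integral_multc)
  qed
  finally show ?thesis by (simp add: \<psi>_def)
qed

text \<open>
  Functions on the torus are integrated in terms of the angles: \<open>torus_point\<close> carries the
  normalized Lebesgue measure of the cube with sides \<open>[0, 2 * pi]\<close> to \<open>torus_measure\<close>.
\<close>

definition angle_cube :: "(real ^ 'd) measure" where
  "angle_cube = uniform_measure lborel (cbox 0 (\<chi> i. 2 * pi))"

definition torus_point :: "real ^ 'd \<Rightarrow> complex ^ 'd" where
  "torus_point \<theta> = (\<chi> i. cis (\<theta> $ i))"

lemma torus_measure_alt: "torus_measure = distr angle_cube borel torus_point"
  by (simp add: torus_measure_def angle_cube_def torus_point_def[abs_def])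

lemma continuous_on_torus_point [continuous_intros]:
  "continuous_on A g \<Longrightarrow> continuous_on A (\<lambda>x. torus_point (g x))"
  unfolding torus_point_def by (intro continuous_intros)

lemma torus_point_measurable [measurable]: "torus_point \<in> borel_measurable borel"
  by (intro borel_measurable_continuous_onI continuous_intros)

lemma norm_torus_point [simp]: "cmod (torus_point \<theta> $ i) = 1"
  by (simp add: torus_point_def)

lemma sets_angle_cube [simp, measurable_cong]: "sets angle_cube = sets borel"
  and space_angle_cube [simp]: "space angle_cube = UNIV"
  by (simp_all add: angle_cube_def uniform_measure_def)

lemma cube_measure:
  "emeasure lborel (cbox 0 (\<chi> i. 2 * pi) :: (real ^ 'd) set) \<noteq> 0"
  "emeasure lborel (cbox 0 (\<chi> i. 2 * pi) :: (real ^ 'd) set) \<noteq> \<infinity>"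
proof -
  let ?v = "(\<chi> i. 2 * pi) :: real ^ 'd"
  have "0 < (\<Prod>b\<in>Basis. (?v - 0) \<bullet> b)"
    by (rule prod_pos) (auto simp: Basis_vec_def inner_axis)
  moreover have "emeasure lborel (cbox 0 ?v) = ennreal (\<Prod>b\<in>Basis. (?v - 0) \<bullet> b)"
    by (rule emeasure_lborel_cbox) (auto simp: Basis_vec_def inner_axis)
  ultimately show "emeasure lborel (cbox 0 ?v) \<noteq> 0"
    by (simp only: ennreal_eq_0_iff not_le)
  show "emeasure lborel (cbox 0 ?v) \<noteq> \<infinity>"
    using emeasure_lborel_cbox_finite[of 0 ?v] by simp
qed

interpretation angle_cube: prob_space "angle_cube :: (real ^ 'd) measure"
  unfolding angle_cube_def using cube_measure by (rule prob_space_uniform_measure)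

lemma AE_angle_cube: "(AE \<theta> in lborel. P \<theta>) \<Longrightarrow> (AE \<theta> in angle_cube. P \<theta>)"
  unfolding angle_cube_def by (rule AE_uniform_measureI) auto

text \<open>
  Adding \<open>t\<close> to every angle multiplies the point of the torus by \<open>cis t\<close>. A property that fails only on
  null sets of each of these diagonal lines holds almost everywhere; this reduces statements about
  radial limits on the torus to the disc.
\<close>

lemma AE_angle_cube_by_diagonals:
  fixes P :: "real ^ 'd \<Rightarrow> bool"
  assumes meas: "{\<theta>. \<not> P \<theta>} \<in> sets borel"
    and null: "\<And>\<theta>. negligible {t. \<not> P (\<theta> + t *\<^sub>R (\<chi> i. 1))}"
  shows "AE \<theta> in angle_cube. P \<theta>"
proof -
  \<comment> \<open>Any coordinate serves to cut the diagonal lines into slabs.\<close>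
  obtain k :: 'd where True by simp
  define A where "A = {\<theta>. \<not> P \<theta>}"
  have A [measurable]: "A \<in> sets borel" using meas by (simp add: A_def)
  have "(\<integral>\<^sup>+t. indicator A (\<theta> + t *\<^sub>R (\<chi> i. 1)) \<partial>lborel) = 0" for \<theta>
  proof -
    have "(\<lambda>t::real. \<theta> + t *\<^sub>R (\<chi> i. 1)) -` A \<inter> space borel \<in> sets borel"
      by (rule measurable_sets[OF _ A]) measurable
    moreover have eq: "(\<lambda>t::real. \<theta> + t *\<^sub>R (\<chi> i. 1)) -` A = {t. \<not> P (\<theta> + t *\<^sub>R (\<chi> i. 1))}"
      by (auto simp: A_def)
    ultimately have S: "{t. \<not> P (\<theta> + t *\<^sub>R (\<chi> i. 1))} \<in> sets borel" by simp
    then have "emeasure lborel {t. \<not> P (\<theta> + t *\<^sub>R (\<chi> i. 1))} = 0"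
      using null[of \<theta>] by (auto simp: negligible_iff_null_sets null_sets_completion_iff)
    then have "(\<integral>\<^sup>+t. indicator {t. \<not> P (\<theta> + t *\<^sub>R (\<chi> i. 1))} t \<partial>lborel) = 0"
      using S by simp
    then show ?thesis by (simp add: A_def indicator_def)
  qed
  then have "(\<integral>\<^sup>+\<theta>. indicator A \<theta> \<partial>lborel) = 0"
    by (subst nn_integral_over_lines[of _ "\<chi> i. 1" "axis k 1"]) (auto simp: inner_axis)
  then have "A \<in> null_sets lborel" by auto
  then have "AE \<theta> in lborel. \<theta> \<notin> A" by (rule AE_not_in)
  then show ?thesis by (intro AE_angle_cube) (simp add: A_def)
qed

text \<open>
  The constant \<open>C\<close> makes the integrand nonnegative. If \<open>g\<close> has mean zero over the \<open>\<nu>\<close>-th angle, the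
  integral over a line in this direction does not depend on \<open>g\<close>.
\<close>

lemma nn_integral_coordinate_line:
  fixes g :: "real ^ 'd \<Rightarrow> real"
  assumes cont: "continuous_on UNIV g" and bd: "\<And>\<theta>. \<bar>g \<theta>\<bar> \<le> C"
    and zero: "((\<lambda>t. g (\<theta> + (t - \<theta> $ \<nu>) *\<^sub>R axis \<nu> 1)) has_integral 0) {0..2 * pi}"
  shows "(\<integral>\<^sup>+t. ennreal (g (\<theta> + t *\<^sub>R axis \<nu> 1) + C) * indicator (cbox 0 (\<chi> i. 2 * pi)) (\<theta> + t *\<^sub>R axis \<nu> 1) \<partial>lborel)
      = ennreal (2 * pi * C) * indicator {\<theta>. \<forall>i. i \<noteq> \<nu> \<longrightarrow> \<theta> $ i \<in> {0..2 * pi}} \<theta>"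
proof -
  define K :: ennreal where "K = indicator {\<theta>. \<forall>i. i \<noteq> \<nu> \<longrightarrow> \<theta> $ i \<in> {0..2 * pi}} \<theta>"
  define p where "p t = \<theta> + (t - \<theta> $ \<nu>) *\<^sub>R axis \<nu> 1" for t
  have contg: "continuous_on UNIV (\<lambda>x. g (h x))" if "continuous_on UNIV h" for h :: "real \<Rightarrow> real ^ 'd"
    using continuous_on_compose2[OF cont that] by simp
  have [measurable]: "(\<lambda>t. g (\<theta> + t *\<^sub>R axis \<nu> 1)) \<in> borel_measurable borel"
    by (intro borel_measurable_continuous_onI contg continuous_intros)
  have [measurable]: "(\<lambda>t. g (p t)) \<in> borel_measurable borel"
    unfolding p_def by (intro borel_measurable_continuous_onI contg continuous_intros)
  have ind: "indicator (cbox 0 (\<chi> i. 2 * pi)) (p t) = K * indicator {0..2 * pi} t" for t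
    by (auto simp: K_def p_def indicator_def mem_box_cart axis_def)
  have "(\<integral>\<^sup>+t. ennreal (g (\<theta> + t *\<^sub>R axis \<nu> 1) + C) * indicator (cbox 0 (\<chi> i. 2 * pi)) (\<theta> + t *\<^sub>R axis \<nu> 1) \<partial>lborel)
      = (\<integral>\<^sup>+t. ennreal (g (p t) + C) * indicator (cbox 0 (\<chi> i. 2 * pi)) (p t) \<partial>lborel)"
    by (subst nn_integral_real_affine[of _ 1 "- \<theta> $ \<nu>"]) (auto simp: p_def)
  also have "\<dots> = (\<integral>\<^sup>+t. K * (ennreal (g (p t) + C) * indicator {0..2 * pi} t) \<partial>lborel)"
    unfolding ind by (simp only: ac_simps)
  also have "\<dots> = K * (\<integral>\<^sup>+t. ennreal (g (p t) + C) * indicator {0..2 * pi} t \<partial>lborel)"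
    by (rule nn_integral_cmult) measurable
  also have "(\<integral>\<^sup>+t. ennreal (g (p t) + C) * indicator {0..2 * pi} t \<partial>lborel) = ennreal (2 * pi * C)"
  proof (rule nn_integral_has_integral_lebesgue')
    show "0 \<le> g (p t) + C" for t using bd[of "p t"] by (simp add: abs_le_iff)
    have "((\<lambda>t. g (p t) + C) has_integral (0 + C * 2 * pi)) {0..2 * pi}"
      using has_integral_add[OF zero has_integral_const_real[of C 0 "2 * pi"]]
      by (simp add: p_def mult_ac)
    then show "((\<lambda>t. g (p t) + C) has_integral (2 * pi * C)) {0..2 * pi}" by (simp add: mult_ac)
  qed
  finally show ?thesis by (simp add: K_def mult.commute)
qed

text \<open>
  The functions \<open>g + C\<close> and \<open>C\<close>, restricted to the cube, have the same integrals over all lines in the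
  direction of the \<open>\<nu>\<close>-th coordinate.
\<close>

lemma angle_cube_mean_zero:
  fixes g :: "real ^ 'd \<Rightarrow> real"
  assumes cont: "continuous_on UNIV g" and bd: "\<And>\<theta>. \<bar>g \<theta>\<bar> \<le> C"
    and zero: "\<And>\<theta>. ((\<lambda>t. g (\<theta> + (t - \<theta> $ \<nu>) *\<^sub>R axis \<nu> 1)) has_integral 0) {0..2 * pi}"
  shows "(\<integral>\<theta>. g \<theta> \<partial>angle_cube) = 0"
proof -
  have [measurable]: "g \<in> borel_measurable borel"
    by (rule borel_measurable_continuous_onI[OF cont])
  have C: "C \<ge> 0" using bd[of 0] by simp
  let ?B = "cbox 0 (\<chi> i. 2 * pi) :: (real ^ 'd) set"
  have F: "(\<integral>\<^sup>+\<theta>. ennreal (k \<theta> + C) * indicator ?B \<theta> \<partial>lborel)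
      = (\<integral>\<^sup>+\<theta>. indicator {0..1} (\<theta> \<bullet> axis \<nu> 1) *
          (ennreal (2 * pi * C) * indicator {\<theta>. \<forall>i. i \<noteq> \<nu> \<longrightarrow> \<theta> $ i \<in> {0..2 * pi}} \<theta>) \<partial>lborel)"
    if "continuous_on UNIV k" "\<And>\<theta>. \<bar>k \<theta>\<bar> \<le> C"
      "\<And>\<theta>. ((\<lambda>t. k (\<theta> + (t - \<theta> $ \<nu>) *\<^sub>R axis \<nu> 1)) has_integral 0) {0..2 * pi}" for k
  proof -
    have [measurable]: "k \<in> borel_measurable borel"
      by (rule borel_measurable_continuous_onI[OF that(1)])
    show ?thesis
      by (subst nn_integral_over_lines[of _ "axis \<nu> 1" "axis \<nu> 1"])
        (simp_all add: nn_integral_coordinate_line[OF that] inner_axis)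
  qed
  have "(\<integral>\<^sup>+\<theta>. ennreal (g \<theta> + C) * indicator ?B \<theta> \<partial>lborel) = (\<integral>\<^sup>+\<theta>. ennreal (0 + C) * indicator ?B \<theta> \<partial>lborel)"
    using F[OF cont bd zero] F[of "\<lambda>_. 0"] C by simp
  then have "(\<integral>\<^sup>+\<theta>. ennreal (g \<theta> + C) \<partial>angle_cube) = (\<integral>\<^sup>+\<theta>. ennreal C \<partial>(angle_cube :: (real ^ 'd) measure))"
    by (simp add: angle_cube_def nn_integral_uniform_measure nn_integral_cmult_indicator ennreal_times_divide)
  then have "(\<integral>\<^sup>+\<theta>. ennreal (g \<theta> + C) \<partial>angle_cube) = ennreal C"
    by (simp add: angle_cube.emeasure_space_1[simplified])
  moreover have "0 \<le> g \<theta> + C" for \<theta> using bd[of \<theta>] by (simp add: abs_le_iff)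
  ultimately have "(\<integral>\<theta>. g \<theta> + C \<partial>angle_cube) = C"
    using C by (subst integral_eq_nn_integral) auto
  moreover have "integrable angle_cube g"
    using bd by (intro angle_cube.integrable_const_bound[of _ C]) auto
  ultimately show ?thesis by (simp add: angle_cube.prob_space[simplified])
qed

text \<open>
  Since \<open>q\<close> takes values in the right half plane, \<open>ln (cmod (q w))\<close> is the real part of the holomorphic
  function \<open>Ln (q w)\<close>, whose mean over the circle is its value \<open>Ln 1 = 0\<close> at the origin.
\<close>

lemma mean_ln_cmod_zero:
  fixes q :: "complex \<Rightarrow> complex"
  assumes hol: "q holomorphic_on cball 0 1" and q0: "q 0 = 1" and pos: "\<And>w. w \<in> cball 0 1 \<Longrightarrow> Re (q w) > 0"
  shows "((\<lambda>t. ln (cmod (q (cis t)))) has_integral 0) {0..2 * pi}"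
proof -
  have nn: "q w \<notin> \<real>\<^sub>\<le>\<^sub>0" if "w \<in> cball 0 1" for w
    using pos[OF that] by (auto simp: complex_nonpos_Reals_iff)
  have "(\<lambda>w. Ln (q w)) holomorphic_on cball 0 1"
    using nn by (intro holomorphic_intros hol) auto
  then have "((\<lambda>w. Ln (q w) / (w - 0)) has_contour_integral 2 * of_real pi * \<i> * Ln (q 0)) (circlepath 0 1)"
    by (rule Cauchy_integral_circlepath_simple) simp
  then have "((\<lambda>t. \<i> * Ln (q (cis t))) has_integral 0) {0..2 * pi}"
    by (simp add: circlepath_def has_contour_integral_part_circlepath_iff q0 mult.commute)
  from has_integral_linear[OF this bounded_linear_Im]
  have "((\<lambda>t. Re (Ln (q (cis t)))) has_integral 0) {0..2 * pi}"
    by (simp add: o_def)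
  moreover have "Re (Ln (q (cis t))) = ln (cmod (q (cis t)))" for t
    using pos[of "cis t"] by (subst Re_Ln) auto
  ultimately show ?thesis by simp
qed

lemma holomorphic_on_slice:
  fixes h :: "complex ^ 'd \<Rightarrow> complex"
  assumes hol: "holomorphic_several h polydisc" and S: "\<And>w. w \<in> S \<Longrightarrow> a + w *s b \<in> polydisc"
  shows "(\<lambda>w. h (a + w *s b)) holomorphic_on S"
proof -
  have "\<exists>D. ((\<lambda>w. h (a + w *s b)) has_field_derivative D) (at w)" if w: "w \<in> S" for w
  proof -
    obtain L where L: "(h has_derivative L) (at (a + w *s b))" "\<And>c v. L (c *s v) = c * L v"
      using hol S[OF w] unfolding holomorphic_several_def by blast
    have "((\<lambda>w. w *s b) has_derivative (\<lambda>w. w *s b)) (at w)"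
    proof (rule bounded_linear_imp_has_derivative)
      show "bounded_linear (\<lambda>w::complex. w *s b)"
        by (intro linear_conv_bounded_linear[THEN iffD1] linearI)
          (simp_all add: vec_eq_iff algebra_simps)
    qed
    then have "((\<lambda>w. a + w *s b) has_derivative (\<lambda>w. w *s b)) (at w)"
      using has_derivative_add[OF has_derivative_const[of a]] by fastforce
    from has_derivative_compose[OF this L(1)]
    have "((\<lambda>w. h (a + w *s b)) has_derivative (\<lambda>w. L b * w)) (at w)"
      by (simp add: L(2) mult.commute)
    then show ?thesis by (auto simp: has_field_derivative_def)
  qed
  then show ?thesis
    unfolding holomorphic_on_def field_differentiable_def
    using has_field_derivative_at_within by blast
qed

section \<open>Radial limits on the torus\<close>

text \<open>
  The Cauchy criterion expresses the existence of a left limit by countably many conditions, each of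
  which bounds distances of pairs of values. For the radial limits below this shows that the set of
  convergence is a Borel set.
\<close>

lemma left_limit_at_1_iff_Cauchy:
  fixes g :: "real \<Rightarrow> 'a::complete_space"
  shows "(\<exists>l. (g \<longlongrightarrow> l) (at_left 1)) \<longleftrightarrow>
    (\<forall>m. \<exists>k. \<forall>p\<in>{1 - 1 / real (Suc k)<..<1}. \<forall>q\<in>{1 - 1 / real (Suc k)<..<1}.
       dist (g p) (g q) \<le> 1 / real (Suc m))" (is "?L \<longleftrightarrow> ?R")
proof
  assume ?L
  then obtain l where l: "(g \<longlongrightarrow> l) (at_left 1)" by blast
  show ?R
  proof
    fix m
    have "1 / (2 * real (Suc m)) > 0" by simp
    from tendstoD[OF l this] obtain b where b: "b < 1"
      "\<And>p. b < p \<Longrightarrow> p < 1 \<Longrightarrow> dist (g p) l < 1 / (2 * real (Suc m))"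
      unfolding eventually_at_left_field by blast
    obtain k where k: "inverse (real (Suc k)) < 1 - b"
      using reals_Archimedean[of "1 - b"] b(1) by auto
    have "dist (g p) (g q) \<le> 1 / real (Suc m)"
      if "p \<in> {1 - 1 / real (Suc k)<..<1}" "q \<in> {1 - 1 / real (Suc k)<..<1}" for p q
    proof -
      have "b < 1 - 1 / real (Suc k)" using k by (simp add: inverse_eq_divide)
      then have "b < p" "p < 1" "b < q" "q < 1" using that by auto
      note b(2)[OF this(1,2)] b(2)[OF this(3,4)]
      then have "dist (g p) (g q) < 1 / (2 * real (Suc m)) + 1 / (2 * real (Suc m))"
        using dist_triangle2[of "g p" "g q" l] by linarith
      also have "\<dots> = 1 / real (Suc m)" by (simp add: field_simps)
      finally show ?thesis by simp
    qed
    then show "\<exists>k. \<forall>p\<in>{1 - 1 / real (Suc k)<..<1}. \<forall>q\<in>{1 - 1 / real (Suc k)<..<1}.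
        dist (g p) (g q) \<le> 1 / real (Suc m)" by blast
  qed
next
  assume R: ?R
  define x where "x n = g (1 - 1 / real (Suc (Suc n)))" for n
  have in_range: "1 - 1 / real (Suc (Suc n)) \<in> {1 - 1 / real (Suc k)<..<1}" if "n \<ge> k" for n k
    using that by (auto simp: field_simps)
  have ev: "\<exists>k. (\<forall>n\<ge>k. \<forall>p\<in>{1 - 1 / real (Suc k)<..<1}. dist (g p) (x n) < e)" if "e > 0" for e
  proof -
    obtain m where m: "inverse (real (Suc m)) < e" using reals_Archimedean[OF \<open>e > 0\<close>] by blast
    obtain k where k: "\<And>p q. p \<in> {1 - 1 / real (Suc k)<..<1} \<Longrightarrow> q \<in> {1 - 1 / real (Suc k)<..<1} \<Longrightarrow>
        dist (g p) (g q) \<le> 1 / real (Suc m)"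
      using R by blast
    have "dist (g p) (x n) < e" if "n \<ge> k" "p \<in> {1 - 1 / real (Suc k)<..<1}" for n p
      using k[OF that(2) in_range[OF that(1)]] m unfolding x_def inverse_eq_divide by linarith
    then show ?thesis by blast
  qed
  have "Cauchy x"
  proof (rule metric_CauchyI)
    fix e :: real assume "e > 0"
    from ev[OF this] obtain k where "\<forall>n\<ge>k. \<forall>p\<in>{1 - 1 / real (Suc k)<..<1}. dist (g p) (x n) < e" by blast
    then show "\<exists>M. \<forall>m\<ge>M. \<forall>n\<ge>M. dist (x m) (x n) < e"
      using in_range unfolding x_def by blast
  qed
  then obtain l where l: "x \<longlonglongrightarrow> l" using Cauchy_convergent convergent_def by blast
  have "(g \<longlongrightarrow> l) (at_left 1)"
  proof (rule tendstoI)
    fix e :: real assume "e > 0"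
    then obtain k where k: "\<forall>n\<ge>k. \<forall>p\<in>{1 - 1 / real (Suc k)<..<1}. dist (g p) (x n) < e / 2"
      using ev[of "e / 2"] by auto
    have "dist (g p) l < e" if "1 - 1 / real (Suc k) < p" "p < 1" for p
    proof -
      have "dist (g p) l \<le> e / 2"
      proof (rule tendsto_upperbound)
        show "(\<lambda>n. dist (g p) (x n)) \<longlonglongrightarrow> dist (g p) l" by (intro tendsto_intros l)
        show "\<forall>\<^sub>F n in sequentially. dist (g p) (x n) \<le> e / 2"
          using k that by (intro eventually_sequentiallyI[of k]) (auto intro: less_imp_le)
      qed simp
      then show ?thesis using \<open>e > 0\<close> by simp
    qed
    moreover have "1 - 1 / real (Suc k) < 1" by simp
    ultimately show "\<forall>\<^sub>F p in at_left 1. dist (g p) l < e"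
      unfolding eventually_at_left_field by blast
  qed
  then show ?L by blast
qed

abbreviation torus :: "(complex ^ 'd) set" where
  "torus \<equiv> {z. \<forall>i. cmod (z $ i) = 1}"

lemma closed_torus: "closed (torus :: (complex ^ 'd) set)"
  by (intro closed_Collect_all closed_Collect_eq continuous_intros)

lemma scaled_torus_in_polydisc:
  "z \<in> torus \<Longrightarrow> 0 \<le> s \<Longrightarrow> s < 1 \<Longrightarrow> s *\<^sub>R z \<in> polydisc"
  by (simp add: polydisc_def)

lemma torus_point_in_torus: "torus_point \<theta> \<in> torus"
  by simp

lemma holomorphic_several_continuous_on: "holomorphic_several h U \<Longrightarrow> continuous_on U h"
  unfolding holomorphic_several_def
  by (meson continuous_at_imp_continuous_on has_derivative_continuous)

lemma continuous_on_scaled_torus: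
  assumes "continuous_on polydisc h" "0 \<le> s" "s < 1"
  shows "continuous_on torus (\<lambda>z. h (s *\<^sub>R z))"
  by (rule continuous_on_compose2[OF assms(1)])
    (use assms scaled_torus_in_polydisc in \<open>auto intro!: continuous_intros\<close>)

text \<open>
  In the Cauchy criterion the innermost conditions range over uncountably many pairs of radii, but each
  of them defines a closed subset of the torus, and so does their conjunction.
\<close>

lemma radial_convergence_set_borel:
  fixes h :: "complex ^ 'd \<Rightarrow> complex"
  assumes cont: "continuous_on polydisc h"
  shows "{z \<in> torus. \<exists>l. ((\<lambda>s::real. h (s *\<^sub>R z)) \<longlongrightarrow> l) (at_left 1)} \<in> sets borel"
proof -
  define I where "I k = {1 - 1 / real (Suc k)<..<1}" for k
  have I: "0 \<le> p" "p < 1" if "p \<in> I k" for p k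
  proof -
    have "1 / real (Suc k) \<le> 1" by simp
    moreover have "1 - 1 / real (Suc k) < p" "p < 1" using that by (simp_all only: I_def greaterThanLessThan_iff)
    ultimately show "0 \<le> p" "p < 1" by linarith+
  qed
  have "closed {z \<in> torus. \<forall>p\<in>I k. \<forall>q\<in>I k. dist (h (p *\<^sub>R z)) (h (q *\<^sub>R z)) \<le> 1 / real (Suc m)}" for k m
  proof -
    have "{z \<in> torus. \<forall>p\<in>I k. \<forall>q\<in>I k. dist (h (p *\<^sub>R z)) (h (q *\<^sub>R z)) \<le> 1 / real (Suc m)} =
      torus \<inter> (\<Inter>p\<in>I k. \<Inter>q\<in>I k. {z \<in> torus. dist (h (p *\<^sub>R z)) (h (q *\<^sub>R z)) \<le> 1 / real (Suc m)})"
      by blast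
    moreover have "closed {z \<in> torus. dist (h (p *\<^sub>R z)) (h (q *\<^sub>R z)) \<le> 1 / real (Suc m)}"
      if "p \<in> I k" "q \<in> I k" for p q
      by (rule continuous_on_closed_Collect_le)
        (use that I in \<open>auto intro!: continuous_intros continuous_on_scaled_torus[OF cont] closed_torus\<close>)
    ultimately show ?thesis using closed_torus by (auto intro!: closed_INT closed_Int)
  qed
  moreover have "{z \<in> torus. \<exists>l. ((\<lambda>s::real. h (s *\<^sub>R z)) \<longlongrightarrow> l) (at_left 1)} =
      (\<Inter>m. \<Union>k. {z \<in> torus. \<forall>p\<in>I k. \<forall>q\<in>I k. dist (h (p *\<^sub>R z)) (h (q *\<^sub>R z)) \<le> 1 / real (Suc m)})"
    unfolding left_limit_at_1_iff_Cauchy I_def by blast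
  ultimately show ?thesis by (auto intro!: sets.countable_INT'' sets.countable_UN borel_closed)
qed

text \<open>
  On a diagonal line of angles the function \<open>h\<close> is seen through its slice \<open>h (w *s z)\<close>, a bounded
  holomorphic function of \<open>w\<close> in the disc, so that Fatou's theorem applies.
\<close>

lemma AE_radial_limit_exists:
  fixes h :: "complex ^ 'd \<Rightarrow> complex"
  assumes h: "h \<in> hol_maps"
  shows "AE \<theta> in angle_cube. \<exists>l. ((\<lambda>s::real. h (s *\<^sub>R torus_point \<theta>)) \<longlongrightarrow> l) (at_left 1)"
proof (rule AE_angle_cube_by_diagonals)
  have hol: "holomorphic_several h polydisc" and le: "\<And>z. z \<in> polydisc \<Longrightarrow> cmod (h z) \<le> 1"
    using h by (auto simp: hol_maps_def)
  let ?R = "{z \<in> torus. \<exists>l. ((\<lambda>s::real. h (s *\<^sub>R z)) \<longlongrightarrow> l) (at_left 1)}"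
  have "?R \<in> sets borel"
    by (rule radial_convergence_set_borel[OF holomorphic_several_continuous_on[OF hol]])
  then have "torus_point -` (- ?R) \<inter> space borel \<in> sets borel"
    by (intro measurable_sets[OF torus_point_measurable]) auto
  moreover have "torus_point -` (- ?R) \<inter> space borel = 
      {\<theta>. \<not> (\<exists>l. ((\<lambda>s::real. h (s *\<^sub>R torus_point \<theta>)) \<longlongrightarrow> l) (at_left 1))}"
    by auto
  ultimately show "{\<theta>. \<not> (\<exists>l. ((\<lambda>s::real. h (s *\<^sub>R torus_point \<theta>)) \<longlongrightarrow> l) (at_left 1))} \<in> sets borel"
    by simp
next
  have hol: "holomorphic_several h polydisc" and le: "\<And>z. z \<in> polydisc \<Longrightarrow> cmod (h z) \<le> 1"
    using h by (auto simp: hol_maps_def)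
  fix \<theta> :: "real ^ 'd"
  define F where "F w = h (0 + w *s torus_point \<theta>)" for w
  have in_disc: "0 + w *s torus_point \<theta> \<in> polydisc" if "w \<in> ball 0 1" for w
    using that by (simp add: polydisc_def norm_mult)
  have "negligible {t. \<nexists>l. ((\<lambda>s. F (of_real s * cis t)) \<longlongrightarrow> l) (at_left 1)}"
  proof (rule Fatou_radial_limits)
    show "F holomorphic_on ball 0 1"
      unfolding F_def using in_disc by (rule holomorphic_on_slice[OF hol])
    show "cmod (F w) \<le> 1" if "w \<in> ball 0 1" for w
      unfolding F_def using in_disc[OF that] by (rule le)
  qed
  moreover have "F (of_real s * cis t) = h (s *\<^sub>R torus_point (\<theta> + t *\<^sub>R (\<chi> i. 1)))" for s t :: real
    unfolding F_def
    by (rule arg_cong[where f = h]) (simp add: vec_eq_iff torus_point_def cis_mult[symmetric] mult_ac scaleR_conv_of_real[where 'a = complex] scaleR_conv_of_real[where 'a = real])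
  ultimately show "negligible {t. \<not> (\<exists>l. ((\<lambda>s::real. h (s *\<^sub>R torus_point (\<theta> + t *\<^sub>R (\<chi> i. 1)))) \<longlongrightarrow> l) (at_left 1))}"
    by simp
qed

section \<open>The Schur recursion at interior points\<close>

text \<open>
  The function \<open>- ln (1 - x)\<close> is convex and vanishes at \<open>0\<close>.
\<close>

lemma ln_defect_convex:
  fixes x c :: real
  assumes "0 \<le> x" "x < 1" "0 \<le> c" "c \<le> 1"
  shows "- ln (1 - c * x) \<le> c * (- ln (1 - x))"
proof -
  have "c * ln (1 - x) + (1 - c) * ln 1 \<le> ln (c *\<^sub>R (1 - x) + (1 - c) *\<^sub>R 1)"
    using ln_concave assms unfolding concave_on_iff
    by (metis add_diff_cancel_left' add.commute diff_gt_0_iff_gt diff_ge_0_iff_ge greaterThan_iff zero_less_one diff_add_cancel)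
  also have "c *\<^sub>R (1 - x) + (1 - c) *\<^sub>R 1 = 1 - c * x" by (simp add: algebra_simps)
  finally show ?thesis by simp
qed

lemma disc_automorphism_defect:
  fixes a r :: complex
  assumes r: "cmod r < 1" and a: "cmod a \<le> 1"
  shows "1 - cmod r \<le> cmod (1 + cnj r * a)"
    and "1 - (cmod ((a + r) / (1 + cnj r * a)))\<^sup>2
      = (1 - (cmod r)\<^sup>2) * (1 - (cmod a)\<^sup>2) / (cmod (1 + cnj r * a))\<^sup>2"
proof -
  have "cmod (cnj r * a) \<le> cmod r"
    using mult_left_mono[OF a, of "cmod r"] by (simp add: norm_mult)
  then show low: "1 - cmod r \<le> cmod (1 + cnj r * a)"
    using norm_diff_ineq[of 1 "cnj r * a"] by simp
  then have pos: "cmod (1 + cnj r * a) > 0" using r by linarith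
  have "(cmod (1 + cnj r * a))\<^sup>2 - (cmod (a + r))\<^sup>2 = (1 - (cmod r)\<^sup>2) * (1 - (cmod a)\<^sup>2)"
    unfolding cmod_power2 by (simp add: power2_eq_square algebra_simps)
  then show "1 - (cmod ((a + r) / (1 + cnj r * a)))\<^sup>2
      = (1 - (cmod r)\<^sup>2) * (1 - (cmod a)\<^sup>2) / (cmod (1 + cnj r * a))\<^sup>2"
    using pos by (simp add: norm_divide power_divide field_simps)
qed

text \<open>
  A run of the Schur algorithm: the iterates \<open>h\<close>, the parameters \<open>r\<close>, and the coordinates \<open>\<nu>\<close> chosen
  along the way, with \<open>\<nu> n\<close> the one that is split off \<open>h n\<close>.
\<close>

locale schur_recursion =
  fixes h :: "nat \<Rightarrow> complex ^ 'd \<Rightarrow> complex" and r :: "nat \<Rightarrow> complex" and \<nu> :: "nat \<Rightarrow> 'd"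
  assumes h_hol: "h n \<in> hol_maps" and r_less: "cmod (r n) < 1"
    and rec: "z \<in> polydisc \<Longrightarrow> h n z = moebius_op (r n) (mult_op (\<nu> n) (h (Suc n))) z"
begin

definition loss :: "nat \<Rightarrow> real" where
  "loss n = - ln (1 - (cmod (r n))\<^sup>2)"

definition denom :: "nat \<Rightarrow> complex ^ 'd \<Rightarrow> complex" where
  "denom n z = 1 + cnj (r n) * (z $ \<nu> n * h (Suc n) z)"

lemma r_sq_less: "(cmod (r n))\<^sup>2 < 1"
  using r_less[of n] by (simp add: power_less_one_iff)

lemma loss_nonneg: "0 \<le> loss n"
  unfolding loss_def using r_sq_less[of n] by (simp add: ln_le_zero_iff)

lemma h_holomorphic: "holomorphic_several (h n) polydisc"
  using h_hol by (simp add: hol_maps_def)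

lemma h_continuous: "continuous_on polydisc (h n)"
  by (rule holomorphic_several_continuous_on[OF h_holomorphic])

lemma h_le: "z \<in> polydisc \<Longrightarrow> cmod (h n z) \<le> 1"
  using h_hol by (simp add: hol_maps_def)

lemma inner_bounds:
  assumes "z \<in> polydisc"
  shows "cmod (z $ \<nu> n * h (Suc n) z) \<le> cmod (z $ \<nu> n)" "cmod (z $ \<nu> n) < 1"
    "cmod (z $ \<nu> n * h (Suc n) z) < 1"
proof -
  show 1: "cmod (z $ \<nu> n * h (Suc n) z) \<le> cmod (z $ \<nu> n)"
    using mult_left_mono[OF h_le[OF assms, of "Suc n"], of "cmod (z $ \<nu> n)"] by (simp add: norm_mult)
  show 2: "cmod (z $ \<nu> n) < 1" using assms by (simp add: polydisc_def)
  show "cmod (z $ \<nu> n * h (Suc n) z) < 1" using 1 2 by simp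
qed

lemma denom_bounds:
  assumes z: "z \<in> polydisc"
  shows "1 - cmod (r n) \<le> cmod (denom n z)" "cmod (denom n z) \<le> 2" "0 < Re (denom n z)" "denom n z \<noteq> 0"
proof -
  define c where "c = cnj (r n) * (z $ \<nu> n * h (Suc n) z)"
  have c: "cmod c < 1"
  proof -
    have "cmod c \<le> cmod (r n) * 1"
      unfolding c_def norm_mult[of "cnj (r n)"] using inner_bounds(3)[OF z, of n]
      by (intro mult_mono) auto
    then show ?thesis using r_less[of n] by simp
  qed
  show "1 - cmod (r n) \<le> cmod (denom n z)"
    unfolding denom_def using disc_automorphism_defect(1)[OF r_less] inner_bounds(3)[OF z] by (simp add: less_imp_le)
  show "cmod (denom n z) \<le> 2"
    using c norm_triangle_ineq[of 1 c] by (simp add: denom_def c_def)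
  show "0 < Re (denom n z)"
    using c abs_Re_le_cmod[of c] by (simp add: denom_def flip: c_def)
  then show "denom n z \<noteq> 0" by auto
qed

lemma h_eq: "z \<in> polydisc \<Longrightarrow> h n z = (z $ \<nu> n * h (Suc n) z + r n) / denom n z"
  using rec[of z n] r_less[of n] by (simp add: moebius_op_def mult_op_def denom_def)

lemma h_defect:
  assumes z: "z \<in> polydisc"
  shows "1 - (cmod (h n z))\<^sup>2
    = (1 - (cmod (r n))\<^sup>2) * (1 - (cmod (z $ \<nu> n))\<^sup>2 * (cmod (h (Suc n) z))\<^sup>2) / (cmod (denom n z))\<^sup>2"
  using disc_automorphism_defect(2)[OF r_less less_imp_le[OF inner_bounds(3)[OF z]], of n n]
  by (simp add: h_eq[OF z, of n] denom_def norm_mult power_mult_distrib)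

lemma h_less: assumes z: "z \<in> polydisc" shows "cmod (h n z) < 1"
proof -
  have "(cmod (z $ \<nu> n))\<^sup>2 * (cmod (h (Suc n) z))\<^sup>2 < 1"
    using inner_bounds(3)[OF z, of n] by (simp add: power_less_one_iff flip: norm_mult power_mult_distrib)
  then have "1 - (cmod (h n z))\<^sup>2 > 0"
    unfolding h_defect[OF z] using r_sq_less denom_bounds(4)[OF z] by (intro divide_pos_pos mult_pos_pos) auto
  then show ?thesis
    using power_less_one_iff[of "cmod (h n z)" 2] by simp
qed

text \<open>
  The integrand of the entropy integral at an interior point.
\<close>

definition energy :: "nat \<Rightarrow> complex ^ 'd \<Rightarrow> real" where
  "energy n z = - ln (1 - (cmod (h n z))\<^sup>2)"

lemma energy_nonneg: "z \<in> polydisc \<Longrightarrow> 0 \<le> energy n z"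
  using h_less[of z n] by (simp add: energy_def ln_le_zero_iff power_less_one_iff power_le_one)

text \<open>
  The logarithm of \<open>h_defect\<close>. Inside the polydisc the coordinate \<open>z $ \<nu> n\<close> has modulus less than one, which is
  why the last term is not the energy of the next iterate.
\<close>

lemma energy_step:
  assumes z: "z \<in> polydisc"
  shows "energy n z = loss n + 2 * ln (cmod (denom n z))
    - ln (1 - (cmod (z $ \<nu> n))\<^sup>2 * (cmod (h (Suc n) z))\<^sup>2)"
proof -
  have pos: "(cmod (z $ \<nu> n))\<^sup>2 * (cmod (h (Suc n) z))\<^sup>2 < 1"
    using inner_bounds(3)[OF z, of n] by (simp add: power_less_one_iff flip: norm_mult power_mult_distrib)
  have "ln (1 - (cmod (h n z))\<^sup>2) = ln (1 - (cmod (r n))\<^sup>2)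
      + ln (1 - (cmod (z $ \<nu> n))\<^sup>2 * (cmod (h (Suc n) z))\<^sup>2) - ln ((cmod (denom n z))\<^sup>2)"
    unfolding h_defect[OF z] using pos r_sq_less[of n] denom_bounds(4)[OF z]
    by (subst ln_div) (auto simp: ln_mult)
  moreover have "ln ((cmod (denom n z))\<^sup>2) = 2 * ln (cmod (denom n z))"
    using denom_bounds(4)[OF z] by (simp add: ln_realpow)
  ultimately show ?thesis by (simp add: energy_def loss_def)
qed

lemma energy_step_le:
  assumes z: "z \<in> polydisc"
  shows "energy n z \<le> loss n + 2 * ln (cmod (denom n z)) + (cmod (z $ \<nu> n))\<^sup>2 * energy (Suc n) z"
proof -
  have "- ln (1 - (cmod (z $ \<nu> n))\<^sup>2 * (cmod (h (Suc n) z))\<^sup>2)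
      \<le> (cmod (z $ \<nu> n))\<^sup>2 * (- ln (1 - (cmod (h (Suc n) z))\<^sup>2))"
    using h_less[OF z, of "Suc n"] inner_bounds(2)[OF z, of n]
    by (intro ln_defect_convex) (auto simp: power_less_one_iff power_le_one)
  then show ?thesis unfolding energy_step[OF z, of n] by (simp add: energy_def)
qed

text \<open>
  A bound on the energy that involves the parameter \<open>r n\<close> but not the later iterates. It controls the remainder
  when the recursion is iterated.
\<close>

lemma energy_le:
  assumes z: "z \<in> polydisc"
  shows "energy n z \<le> loss n + ln (4 / (1 - (cmod (z $ \<nu> n))\<^sup>2))"
proof -
  let ?s = "(cmod (z $ \<nu> n))\<^sup>2"
  have s: "?s < 1" using inner_bounds(2)[OF z, of n] by (simp add: power_less_one_iff)
  have "?s * (cmod (h (Suc n) z))\<^sup>2 \<le> ?s * 1"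
    using h_le[OF z, of "Suc n"] by (intro mult_left_mono) (auto simp: power_le_one)
  then have "ln (1 - ?s) \<le> ln (1 - ?s * (cmod (h (Suc n) z))\<^sup>2)"
    using s by (subst ln_le_cancel_iff) auto
  moreover have "2 * ln (cmod (denom n z)) \<le> 2 * ln 2"
    using denom_bounds(2,4)[OF z, of n] by simp
  moreover have "ln (4 / (1 - ?s)) = 2 * ln 2 - ln (1 - ?s)"
    using s by (subst ln_div) (auto simp: ln_realpow[of 2 2, simplified])
  ultimately show ?thesis unfolding energy_step[OF z] by linarith
qed

lemma denom_continuous: "continuous_on polydisc (denom n)"
  unfolding denom_def by (intro continuous_intros h_continuous)

lemma energy_continuous: "continuous_on polydisc (energy n)"
proof -
  have "0 < 1 - (cmod (h n z))\<^sup>2" if "z \<in> polydisc" for z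
    using h_less[OF that] by (simp add: power_less_one_iff)
  then show ?thesis
    unfolding energy_def by (intro continuous_intros h_continuous) force
qed

lemma circle_in_polydisc: "0 \<le> s \<Longrightarrow> s < 1 \<Longrightarrow> s *\<^sub>R torus_point \<theta> \<in> polydisc"
  by (rule scaled_torus_in_polydisc[OF torus_point_in_torus])

lemma continuous_on_circle:
  fixes F :: "complex ^ 'd \<Rightarrow> 'a::topological_space"
  assumes "continuous_on polydisc F" "0 \<le> s" "s < 1"
  shows "continuous_on UNIV (\<lambda>\<theta>. F (s *\<^sub>R torus_point \<theta>))"
  by (rule continuous_on_compose2[OF assms(1)])
    (use assms circle_in_polydisc in \<open>auto intro!: continuous_intros\<close>)

lemma ln_denom_bound:
  assumes z: "z \<in> polydisc"
  shows "\<bar>ln (cmod (denom n z))\<bar> \<le> ln 2 - ln (1 - cmod (r n))"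
proof -
  have "ln (1 - cmod (r n)) \<le> ln (cmod (denom n z))" "ln (cmod (denom n z)) \<le> ln 2"
    using denom_bounds[OF z, of n] r_less[of n] by auto
  moreover have "ln (1 - cmod (r n)) \<le> 0" "0 \<le> ln (2 :: real)"
    using r_less[of n] by (auto simp: ln_le_zero_iff)
  ultimately show ?thesis by linarith
qed

lemma ln_denom_continuous: "continuous_on polydisc (\<lambda>z. ln (cmod (denom n z)))"
  using denom_bounds(4) by (intro continuous_intros denom_continuous) auto

text \<open>
  As a function of the coordinate \<open>\<nu> n\<close> alone, the denominator is holomorphic in a neighbourhood of the
  closed disc, has positive real part and takes the value \<open>1\<close> at \<open>0\<close>, because that coordinate is a factor of
  the second summand. So the logarithm of its modulus already has mean zero over this one angle.
\<close>

lemma integral_ln_denom: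
  assumes s: "0 \<le> s" "s < 1"
  shows "(\<integral>\<theta>. ln (cmod (denom n (s *\<^sub>R torus_point \<theta>))) \<partial>angle_cube) = 0"
proof (rule angle_cube_mean_zero[where \<nu> = "\<nu> n"])
  show "continuous_on UNIV (\<lambda>\<theta>. ln (cmod (denom n (s *\<^sub>R torus_point \<theta>))))"
    by (rule continuous_on_circle[OF ln_denom_continuous s])
  show "\<bar>ln (cmod (denom n (s *\<^sub>R torus_point \<theta>)))\<bar> \<le> ln 2 - ln (1 - cmod (r n))" for \<theta>
    by (rule ln_denom_bound[OF circle_in_polydisc[OF s]])
next
  fix \<theta> :: "real ^ 'd"
  \<comment> \<open>The point with the \<open>\<nu> n\<close>-th angle replaced by \<open>t\<close> lies on the complex line through \<open>a\<close> in the direction \<open>b\<close>.\<close>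
  define a :: "complex ^ 'd" where "a = (\<chi> i. if i = \<nu> n then 0 else s * cis (\<theta> $ i))"
  define b :: "complex ^ 'd" where "b = axis (\<nu> n) (of_real s)"
  have line: "s *\<^sub>R torus_point (\<theta> + (t - \<theta> $ \<nu> n) *\<^sub>R axis (\<nu> n) 1) = a + cis t *s b" for t
    by (simp add: vec_eq_iff a_def b_def torus_point_def axis_def scaleR_conv_of_real[where 'a = complex] mult.commute)
  have in_polydisc: "a + w *s b \<in> polydisc" if "w \<in> cball 0 1" for w
  proof -
    have "cmod w * s < 1" using that s mult_right_mono[of "cmod w" 1 s] by simp
    then show ?thesis
      using s by (auto simp: polydisc_def a_def b_def axis_def norm_mult)
  qed
  have comp: "(a + w *s b) $ \<nu> n = w * s" for w
    by (simp add: a_def b_def)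
  define q where "q w = denom n (a + w *s b)" for w
  have "((\<lambda>t. ln (cmod (q (cis t)))) has_integral 0) {0..2 * pi}"
  proof (rule mean_ln_cmod_zero)
    show "q holomorphic_on cball 0 1"
      unfolding q_def denom_def comp
      by (intro holomorphic_intros holomorphic_on_slice[OF h_holomorphic] in_polydisc)
    show "q 0 = 1" by (simp add: q_def denom_def comp[of 0, simplified])
    show "0 < Re (q w)" if "w \<in> cball 0 1" for w
      unfolding q_def by (rule denom_bounds(3)[OF in_polydisc[OF that]])
  qed
  then show "((\<lambda>t. ln (cmod (denom n (s *\<^sub>R torus_point (\<theta> + (t - \<theta> $ \<nu> n) *\<^sub>R axis (\<nu> n) 1))))) has_integral 0) {0..2 * pi}"
    by (simp add: line q_def)
qed

lemma integrable_ln_denom: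
  assumes s: "0 \<le> s" "s < 1"
  shows "integrable angle_cube (\<lambda>\<theta>. ln (cmod (denom n (s *\<^sub>R torus_point \<theta>))))"
  using ln_denom_bound[OF circle_in_polydisc[OF s]]
    borel_measurable_continuous_onI[OF continuous_on_circle[OF ln_denom_continuous s]]
  by (intro angle_cube.integrable_const_bound[of _ "ln 2 - ln (1 - cmod (r n))"]) auto

lemma integrable_energy:
  assumes s: "0 \<le> s" "s < 1"
  shows "integrable angle_cube (\<lambda>\<theta>. energy n (s *\<^sub>R torus_point \<theta>))"
  using energy_le[OF circle_in_polydisc[OF s], of n] energy_nonneg[OF circle_in_polydisc[OF s], of n]
    borel_measurable_continuous_onI[OF continuous_on_circle[OF energy_continuous s]] s
  by (intro angle_cube.integrable_const_bound[of _ "loss n + ln (4 / (1 - s\<^sup>2))"]) auto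

definition mean_energy :: "real \<Rightarrow> nat \<Rightarrow> real" where
  "mean_energy s n = (\<integral>\<theta>. energy n (s *\<^sub>R torus_point \<theta>) \<partial>angle_cube)"

lemma mean_energy_step:
  assumes s: "0 \<le> s" "s < 1"
  shows "mean_energy s n \<le> loss n + s\<^sup>2 * mean_energy s (Suc n)"
proof -
  have "mean_energy s n \<le> (\<integral>\<theta>. loss n + 2 * ln (cmod (denom n (s *\<^sub>R torus_point \<theta>)))
      + s\<^sup>2 * energy (Suc n) (s *\<^sub>R torus_point \<theta>) \<partial>angle_cube)"
    unfolding mean_energy_def
  proof (rule integral_mono)
    show "energy n (s *\<^sub>R torus_point \<theta>) \<le> loss n + 2 * ln (cmod (denom n (s *\<^sub>R torus_point \<theta>)))
      + s\<^sup>2 * energy (Suc n) (s *\<^sub>R torus_point \<theta>)" for \<theta>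
      using energy_step_le[OF circle_in_polydisc[OF s], of n \<theta>] s by simp
  qed (intro integrable_energy Bochner_Integration.integrable_add integrable_mult_right
      integrable_ln_denom angle_cube.integrable_const s)+
  also have "\<dots> = loss n + s\<^sup>2 * mean_energy s (Suc n)"
    using integrable_ln_denom[OF s, of n] integrable_energy[OF s, of "Suc n"]
    by (simp add: integral_ln_denom[OF s] mean_energy_def angle_cube.prob_space[simplified])
  finally show ?thesis .
qed

lemma mean_energy_le:
  assumes s: "0 \<le> s" "s < 1"
  shows "mean_energy s n \<le> loss n + ln (4 / (1 - s\<^sup>2))"
proof -
  have "mean_energy s n \<le> (\<integral>\<theta>. loss n + ln (4 / (1 - s\<^sup>2)) \<partial>(angle_cube :: (real ^ 'd) measure))"
    unfolding mean_energy_def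
  proof (rule integral_mono)
    show "energy n (s *\<^sub>R torus_point \<theta>) \<le> loss n + ln (4 / (1 - s\<^sup>2))" for \<theta>
      using energy_le[OF circle_in_polydisc[OF s], of n \<theta>] s by simp
  qed (intro integrable_energy angle_cube.integrable_const s)+
  then show ?thesis by (simp add: angle_cube.prob_space[simplified])
qed

text \<open>
  Iterating \<open>mean_energy_step\<close> gives coefficients \<open>(s\<^sup>2) ^ j\<close> for the losses, which are bounded by one; the
  power in front of the remainder is kept, since it makes the remainder vanish in the limit.
\<close>

lemma mean_energy_le_sum:
  assumes s: "0 \<le> s" "s < 1"
  shows "mean_energy s 0 \<le> (\<Sum>j<N. loss j) + (s\<^sup>2) ^ N * mean_energy s N"
proof (induction N)
  case (Suc N)
  have "(s\<^sup>2) ^ N * mean_energy s N \<le> (s\<^sup>2) ^ N * (loss N + s\<^sup>2 * mean_energy s (Suc N))"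
    by (rule mult_left_mono[OF mean_energy_step[OF s]]) simp
  also have "\<dots> \<le> loss N + (s\<^sup>2) ^ Suc N * mean_energy s (Suc N)"
  proof -
    have "(s\<^sup>2) ^ N * loss N \<le> 1 * loss N"
      using s loss_nonneg by (intro mult_right_mono) (auto simp: power_le_one)
    then show ?thesis by (simp add: algebra_simps)
  qed
  finally show ?case using Suc by simp
qed simp

text \<open>
  If the losses are summable, \<open>M\<close> bounds the remainder for all \<open>N\<close> at once, and its coefficient tends to zero
  since \<open>s < 1\<close>.
\<close>

lemma mean_energy_le_suminf:
  assumes s: "0 \<le> s" "s < 1" and sum: "summable loss"
  shows "mean_energy s 0 \<le> suminf loss"
proof -
  define M where "M = suminf loss + ln (4 / (1 - s\<^sup>2))"
  have "mean_energy s 0 \<le> suminf loss + (s\<^sup>2) ^ N * M" for N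
  proof -
    have "loss N \<le> suminf loss"
      using sum_le_suminf[OF sum, of "{N}"] loss_nonneg by simp
    then have "mean_energy s N \<le> M"
      using mean_energy_le[OF s, of N] by (simp add: M_def)
    then have "(s\<^sup>2) ^ N * mean_energy s N \<le> (s\<^sup>2) ^ N * M" by (intro mult_left_mono) auto
    moreover have "(\<Sum>j<N. loss j) \<le> suminf loss"
      using sum_le_suminf[OF sum] loss_nonneg by simp
    ultimately show ?thesis using mean_energy_le_sum[OF s, of N] by linarith
  qed
  moreover have "(\<lambda>N. suminf loss + (s\<^sup>2) ^ N * M) \<longlonglongrightarrow> suminf loss + 0 * M"
    using s by (intro tendsto_intros LIMSEQ_power_zero) (auto simp: power_less_one_iff)
  ultimately show ?thesis
    using LIMSEQ_le_const by (metis (no_types, lifting) add_0_right mult_zero_left)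
qed

end

section \<open>Boundary values and the entropy integral\<close>

text \<open>
  The integrand of the entropy integral at a boundary value, with values in \<open>[0, \<infinity>]\<close>.
\<close>

definition deficit :: "complex \<Rightarrow> ennreal" where
  "deficit w = e2ennreal (- ext_ln (1 - (cmod w)\<^sup>2))"

lemma deficit_less: "cmod w < 1 \<Longrightarrow> deficit w = ennreal (- ln (1 - (cmod w)\<^sup>2))"
  by (simp add: deficit_def ext_ln_def power_less_one_iff not_le e2ennreal_ereal)

lemma deficit_top: "1 \<le> cmod w \<Longrightarrow> deficit w = top"
  by (simp add: deficit_def ext_ln_def one_le_power)

lemma le_deficit:
  assumes "1 - (cmod w)\<^sup>2 \<le> exp (- g)"
  shows "ennreal g \<le> deficit w"
proof (cases "cmod w < 1")
  case True
  then have "0 < 1 - (cmod w)\<^sup>2" by (simp add: power_less_one_iff)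
  then have "ln (1 - (cmod w)\<^sup>2) \<le> ln (exp (- g))"
    using assms by (subst ln_le_cancel_iff) auto
  then show ?thesis using True by (simp add: deficit_less ennreal_leI)
qed (simp add: deficit_top)

lemma tendsto_deficit:
  assumes x: "(x \<longlongrightarrow> L) F" and less: "\<forall>\<^sub>F s in F. cmod (x s) < 1"
  shows "((\<lambda>s. ennreal (- ln (1 - (cmod (x s))\<^sup>2))) \<longlongrightarrow> deficit L) F"
proof (cases "cmod L < 1")
  case True
  then have "1 - (cmod L)\<^sup>2 \<noteq> 0" by (metis diff_eq_eq add_0 less_irrefl norm_ge_zero power_one power_strict_mono zero_less_numeral)
  then show ?thesis
    unfolding deficit_less[OF True] by (intro tendsto_intros x) auto
next
  case False
  have lim: "((\<lambda>s. 1 - (cmod (x s))\<^sup>2) \<longlongrightarrow> 1 - (cmod L)\<^sup>2) F"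
    by (intro tendsto_intros x)
  have pos: "\<forall>\<^sub>F s in F. 0 < 1 - (cmod (x s))\<^sup>2"
    using less by eventually_elim (simp add: power_less_one_iff)
  show ?thesis
  proof (cases "F = bot")
    case nontriv: False
    have "\<forall>\<^sub>F s in F. 0 \<le> 1 - (cmod (x s))\<^sup>2"
      using pos by eventually_elim (rule less_imp_le)
    then have "0 \<le> 1 - (cmod L)\<^sup>2"
      by (rule tendsto_lowerbound[OF lim _ nontriv])
    moreover have "1 \<le> (cmod L)\<^sup>2" using False by (simp add: one_le_power)
    ultimately have "1 - (cmod L)\<^sup>2 = 0" by simp
    then have "filterlim (\<lambda>s. 1 - (cmod (x s))\<^sup>2) (at_right 0) F"
      using lim pos by (auto simp: filterlim_at elim: eventually_mono)
    then have "filterlim (\<lambda>s. ln (1 - (cmod (x s))\<^sup>2)) at_bot F"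
      by (rule filterlim_compose[OF ln_at_0])
    then show ?thesis
      using False by (simp add: deficit_top ennreal_tendsto_top_eq_at_top filterlim_uminus_at_top)
  qed simp
qed

lemma ennreal_integral_le_nn_integral:
  assumes "integrable M f"
  shows "ennreal (\<integral>x. f x \<partial>M) \<le> (\<integral>\<^sup>+x. ennreal (f x) \<partial>M)"
proof -
  have "(\<integral>x. f x \<partial>M) \<le> (\<integral>x. max 0 (f x) \<partial>M)"
    using assms by (intro integral_mono) auto
  then have "ennreal (\<integral>x. f x \<partial>M) \<le> ennreal (\<integral>x. max 0 (f x) \<partial>M)"
    by (rule ennreal_leI)
  also have "\<dots> = (\<integral>\<^sup>+x. ennreal (max 0 (f x)) \<partial>M)"
    using assms by (intro nn_integral_eq_integral[symmetric]) auto
  also have "\<dots> = (\<integral>\<^sup>+x. ennreal (f x) \<partial>M)"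
    by (intro nn_integral_cong) (simp add: max_def ennreal_neg)
  finally show ?thesis .
qed

definition radius :: "nat \<Rightarrow> real" where
  "radius k = 1 - 1 / real (k + 2)"

lemma radius: "0 \<le> radius k" "radius k < 1"
  by (auto simp: radius_def)

lemma radius_tendsto: "filterlim radius (at_left 1) sequentially"
proof -
  have "(\<lambda>k. 1 - 1 / real (k + 2)) \<longlonglongrightarrow> 1 - 0"
    by (intro tendsto_diff tendsto_const LIMSEQ_ignore_initial_segment[OF lim_1_over_n])
  then show ?thesis
    unfolding filterlim_at using radius(2) by (auto simp: radius_def[abs_def])
qed

lemma eventually_left_unit: "\<forall>\<^sub>F s::real in at_left 1. 0 < s \<and> s < 1"
  unfolding eventually_at_left_field by (intro exI[of _ 0]) auto

context schur_recursion
begin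

definition has_limit :: "complex ^ 'd \<Rightarrow> nat \<Rightarrow> complex \<Rightarrow> bool" where
  "has_limit z n L \<longleftrightarrow> ((\<lambda>s::real. h n (s *\<^sub>R z)) \<longlongrightarrow> L) (at_left 1)"

lemma eventually_in_polydisc:
  assumes "z \<in> torus" shows "\<forall>\<^sub>F s::real in at_left 1. s *\<^sub>R z \<in> polydisc"
  using eventually_left_unit by eventually_elim (use scaled_torus_in_polydisc[OF assms] in auto)

lemma limit_le:
  assumes z: "z \<in> torus" and L: "has_limit z n L"
  shows "cmod L \<le> 1"
proof (rule tendsto_upperbound)
  show "((\<lambda>s::real. cmod (h n (s *\<^sub>R z))) \<longlongrightarrow> cmod L) (at_left 1)"
    using L unfolding has_limit_def by (rule tendsto_norm)
  show "\<forall>\<^sub>F s::real in at_left 1. cmod (h n (s *\<^sub>R z)) \<le> 1"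
    using eventually_in_polydisc[OF z] by eventually_elim (rule h_le)
qed simp

lemma h_Suc_eq:
  assumes z: "z \<in> polydisc" "z $ \<nu> n \<noteq> 0"
  shows "h (Suc n) z = (h n z - r n) / (1 - cnj (r n) * h n z) / z $ \<nu> n"
proof -
  define A where "A = z $ \<nu> n * h (Suc n) z"
  have "cmod (cnj (r n) * h n z) \<le> cmod (r n) * 1"
    unfolding norm_mult using h_le[OF z(1)] by (intro mult_mono) auto
  then have "cmod (cnj (r n) * h n z) < 1" using r_less[of n] by simp
  then have ne: "1 - cnj (r n) * h n z \<noteq> 0" by auto
  have "h n z * denom n z = A + r n"
    using h_eq[OF z(1), of n] denom_bounds(4)[OF z(1), of n] by (simp add: A_def)
  then have "A * (1 - cnj (r n) * h n z) = h n z - r n"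
    by (simp add: denom_def algebra_simps flip: A_def)
  then show ?thesis using ne z(2) by (simp add: A_def field_simps)
qed

text \<open>
  Each step of the Schur algorithm is inverted by a disc automorphism, and \<open>z $ \<nu> n\<close> has modulus one on the
  torus. So radial limits pass from \<open>h n\<close> to \<open>h (Suc n)\<close>.
\<close>

lemma limit_Suc:
  assumes z: "z \<in> torus" and L: "has_limit z n L"
  shows "\<exists>L'. has_limit z (Suc n) L'"
proof -
  have "cmod (cnj (r n) * L) \<le> cmod (r n) * 1"
    unfolding norm_mult using limit_le[OF z L] by (intro mult_mono) auto
  then have "cmod (cnj (r n) * L) < 1" using r_less[of n] by simp
  then have ne: "1 - cnj (r n) * L \<noteq> 0" by auto
  have "cmod (z $ \<nu> n) = 1" using z by simp
  then have zn: "z $ \<nu> n \<noteq> 0" by auto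
  have "((\<lambda>s::real. (h n (s *\<^sub>R z) - r n) / (1 - cnj (r n) * h n (s *\<^sub>R z)) / (s *\<^sub>R z) $ \<nu> n)
      \<longlongrightarrow> (L - r n) / (1 - cnj (r n) * L) / (1 *\<^sub>R z) $ \<nu> n) (at_left 1)"
    using L ne zn unfolding has_limit_def by (intro tendsto_intros) auto
  moreover have "\<forall>\<^sub>F s::real in at_left 1. (h n (s *\<^sub>R z) - r n) / (1 - cnj (r n) * h n (s *\<^sub>R z)) / (s *\<^sub>R z) $ \<nu> n
      = h (Suc n) (s *\<^sub>R z)"
    using eventually_in_polydisc[OF z] eventually_left_unit
  proof eventually_elim
    case (elim s)
    then show ?case
      using h_Suc_eq[of "s *\<^sub>R z" n] zn by simp
  qed
  ultimately show ?thesis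
    unfolding has_limit_def by (intro exI) (rule Lim_transform_eventually)
qed

text \<open>
  The limit of \<open>h_defect\<close> at the boundary. The modulus of \<open>z $ \<nu> n\<close> tends to one there.
\<close>

lemma limit_step:
  assumes z: "z \<in> torus" and L: "has_limit z n L" and L': "has_limit z (Suc n) L'"
  obtains Q where "((\<lambda>s::real. denom n (s *\<^sub>R z)) \<longlongrightarrow> Q) (at_left 1)" "Q \<noteq> 0"
    "1 - (cmod L)\<^sup>2 = (1 - (cmod (r n))\<^sup>2) * (1 - (cmod L')\<^sup>2) / (cmod Q)\<^sup>2"
proof -
  define Q where "Q = 1 + cnj (r n) * ((1 *\<^sub>R z) $ \<nu> n * L')"
  have Q: "((\<lambda>s::real. denom n (s *\<^sub>R z)) \<longlongrightarrow> Q) (at_left 1)"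
    using L' unfolding denom_def Q_def has_limit_def by (intro tendsto_intros)
  have "1 - cmod (r n) \<le> cmod Q"
  proof (rule tendsto_lowerbound)
    show "((\<lambda>s::real. cmod (denom n (s *\<^sub>R z))) \<longlongrightarrow> cmod Q) (at_left 1)"
      by (intro tendsto_intros Q)
    show "\<forall>\<^sub>F s::real in at_left 1. 1 - cmod (r n) \<le> cmod (denom n (s *\<^sub>R z))"
      using eventually_in_polydisc[OF z] by eventually_elim (rule denom_bounds(1))
  qed simp
  then have Q0: "Q \<noteq> 0" using r_less[of n] by auto
  let ?lhs = "\<lambda>s::real. 1 - (cmod (h n (s *\<^sub>R z)))\<^sup>2"
  let ?rhs = "\<lambda>s::real. (1 - (cmod (r n))\<^sup>2) * (1 - (cmod ((s *\<^sub>R z) $ \<nu> n))\<^sup>2 * (cmod (h (Suc n) (s *\<^sub>R z)))\<^sup>2)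
       / (cmod (denom n (s *\<^sub>R z)))\<^sup>2"
  have lhs: "(?lhs \<longlongrightarrow> 1 - (cmod L)\<^sup>2) (at_left 1)"
    using L unfolding has_limit_def by (intro tendsto_intros)
  have rhs: "(?rhs \<longlongrightarrow> (1 - (cmod (r n))\<^sup>2) * (1 - (cmod ((1 *\<^sub>R z) $ \<nu> n))\<^sup>2 * (cmod L')\<^sup>2) / (cmod Q)\<^sup>2) (at_left 1)"
    using L' Q0 unfolding has_limit_def by (intro tendsto_intros Q) auto
  have "\<forall>\<^sub>F s in at_left 1. ?rhs s = ?lhs s"
    using eventually_in_polydisc[OF z] by eventually_elim (rule h_defect[symmetric])
  from tendsto_unique[OF trivial_limit_at_left_real lhs Lim_transform_eventually[OF rhs this]]
  have "1 - (cmod L)\<^sup>2 = (1 - (cmod (r n))\<^sup>2) * (1 - (cmod ((1 *\<^sub>R z) $ \<nu> n))\<^sup>2 * (cmod L')\<^sup>2) / (cmod Q)\<^sup>2" .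
  then have "1 - (cmod L)\<^sup>2 = (1 - (cmod (r n))\<^sup>2) * (1 - (cmod L')\<^sup>2) / (cmod Q)\<^sup>2"
    using z by simp
  then show thesis using that Q Q0 by blast
qed

text \<open>
  The part of the boundary deficit of \<open>h 0\<close> that is produced by the first \<open>N\<close> steps; its mean over the torus is the
  sum of the first \<open>N\<close> losses.
\<close>

definition gain :: "nat \<Rightarrow> complex ^ 'd \<Rightarrow> real" where
  "gain N z = (\<Sum>j<N. loss j + 2 * ln (cmod (denom j z)))"

text \<open>
  The first \<open>N\<close> instances of \<open>limit_step\<close> multiplied together. The factor with \<open>L\<close> on the right is what the
  remaining steps still have to account for.
\<close>

lemma gain_limit:
  assumes z: "z \<in> torus" and L0: "has_limit z 0 L0"
  shows "\<exists>G L. ((\<lambda>s::real. gain N (s *\<^sub>R z)) \<longlongrightarrow> G) (at_left 1) \<and> has_limit z N L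
    \<and> 1 - (cmod L0)\<^sup>2 = exp (- G) * (1 - (cmod L)\<^sup>2)"
proof (induction N)
  case 0
  then show ?case using L0 by (intro exI[of _ 0] exI[of _ L0]) (simp add: gain_def)
next
  case (Suc N)
  then obtain G L where GL: "((\<lambda>s::real. gain N (s *\<^sub>R z)) \<longlongrightarrow> G) (at_left 1)" "has_limit z N L"
    "1 - (cmod L0)\<^sup>2 = exp (- G) * (1 - (cmod L)\<^sup>2)" by blast
  obtain L' where L': "has_limit z (Suc N) L'" using limit_Suc[OF z GL(2)] by blast
  obtain Q where Q: "((\<lambda>s::real. denom N (s *\<^sub>R z)) \<longlongrightarrow> Q) (at_left 1)" "Q \<noteq> 0"
    "1 - (cmod L)\<^sup>2 = (1 - (cmod (r N))\<^sup>2) * (1 - (cmod L')\<^sup>2) / (cmod Q)\<^sup>2"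
    using limit_step[OF z GL(2) L'] by blast
  define G' where "G' = G + (loss N + 2 * ln (cmod Q))"
  have "((\<lambda>s::real. gain N (s *\<^sub>R z) + (loss N + 2 * ln (cmod (denom N (s *\<^sub>R z))))) \<longlongrightarrow> G') (at_left 1)"
    unfolding G'_def using Q(2) by (intro tendsto_intros GL Q) auto
  then have "((\<lambda>s::real. gain (Suc N) (s *\<^sub>R z)) \<longlongrightarrow> G') (at_left 1)"
    by (simp add: gain_def)
  moreover have "1 - (cmod L0)\<^sup>2 = exp (- G') * (1 - (cmod L')\<^sup>2)"
  proof -
    have "exp (- loss N) = 1 - (cmod (r N))\<^sup>2"
      using r_sq_less[of N] by (simp add: loss_def)
    moreover have "exp (2 * ln (cmod Q)) = (cmod Q)\<^sup>2"
      using Q(2) by (simp add: exp_double)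
    moreover have "exp (- G') = exp (- G) * exp (- loss N) / exp (2 * ln (cmod Q))"
      by (simp add: G'_def exp_diff exp_add exp_minus field_simps)
    ultimately show ?thesis
      unfolding GL(3) Q(3) by simp
  qed
  ultimately show ?case using L' by blast
qed

lemma radial_limit_eq: "has_limit z 0 L \<Longrightarrow> radial_limit (h 0) z = L"
  unfolding has_limit_def radial_limit_def by (rule tendsto_Lim) simp_all

lemma AE_has_limit: "AE \<theta> in angle_cube. \<exists>L. has_limit (torus_point \<theta>) 0 L"
  unfolding has_limit_def by (rule AE_radial_limit_exists[OF h_hol])

lemma gain_bound: "z \<in> polydisc \<Longrightarrow> \<bar>gain N z\<bar> \<le> (\<Sum>j<N. loss j + 2 * (ln 2 - ln (1 - cmod (r j))))"
  unfolding gain_def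
proof (rule order_trans[OF sum_abs sum_mono])
  fix j assume z: "z \<in> polydisc"
  show "\<bar>loss j + 2 * ln (cmod (denom j z))\<bar> \<le> loss j + 2 * (ln 2 - ln (1 - cmod (r j)))"
  proof -
    have "\<bar>loss j + 2 * ln (cmod (denom j z))\<bar> \<le> \<bar>loss j\<bar> + \<bar>2 * ln (cmod (denom j z))\<bar>"
      by (rule abs_triangle_ineq)
    moreover have "\<bar>2 * ln (cmod (denom j z))\<bar> = 2 * \<bar>ln (cmod (denom j z))\<bar>"
      by (simp add: abs_mult)
    moreover have "2 * \<bar>ln (cmod (denom j z))\<bar> \<le> 2 * (ln 2 - ln (1 - cmod (r j)))"
      by (rule mult_left_mono[OF ln_denom_bound[OF z]]) simp
    moreover have "\<bar>loss j\<bar> = loss j" using loss_nonneg by (rule abs_of_nonneg)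
    ultimately show ?thesis by linarith
  qed
qed

text \<open>
  The boundary value of \<open>gain N\<close> is at most the deficit by \<open>gain_limit\<close>. Its integral is the limit of the
  integrals over the inner tori by dominated convergence, because the logarithms of the denominators are
  bounded uniformly in the radius.
\<close>

lemma sum_loss_le_boundary_deficit:
  "ennreal (\<Sum>j<N. loss j) \<le> (\<integral>\<^sup>+\<theta>. deficit (radial_limit (h 0) (torus_point \<theta>)) \<partial>angle_cube)"
proof -
  define g where "g k \<theta> = gain N (radius k *\<^sub>R torus_point \<theta>)" for k \<theta>
  define G where "G \<theta> = lim (\<lambda>k. g k \<theta>)" for \<theta>
  have [measurable]: "(\<lambda>\<theta>. ln (cmod (denom j (radius k *\<^sub>R torus_point \<theta>)))) \<in> borel_measurable borel" for j k
    by (rule borel_measurable_continuous_onI[OF continuous_on_circle[OF ln_denom_continuous radius]])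
  have [measurable]: "g k \<in> borel_measurable borel" for k
    unfolding g_def gain_def by measurable
  have [measurable]: "G \<in> borel_measurable borel"
    unfolding G_def by (rule borel_measurable_lim_metric) measurable
  have lim: "AE \<theta> in angle_cube. (\<lambda>k. g k \<theta>) \<longlonglongrightarrow> G \<theta> \<and> ennreal (G \<theta>) \<le> deficit (radial_limit (h 0) (torus_point \<theta>))"
    using AE_has_limit
  proof eventually_elim
    case (elim \<theta>)
    then obtain L0 where L0: "has_limit (torus_point \<theta>) 0 L0" by blast
    obtain A L where A: "((\<lambda>s::real. gain N (s *\<^sub>R torus_point \<theta>)) \<longlongrightarrow> A) (at_left 1)"
      "has_limit (torus_point \<theta>) N L" "1 - (cmod L0)\<^sup>2 = exp (- A) * (1 - (cmod L)\<^sup>2)"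
      using gain_limit[OF torus_point_in_torus L0] by blast
    have gA: "(\<lambda>k. g k \<theta>) \<longlonglongrightarrow> A"
      unfolding g_def by (rule filterlim_compose[OF A(1) radius_tendsto])
    then have "G \<theta> = A" unfolding G_def by (rule limI)
    moreover have "exp (- A) * (1 - (cmod L)\<^sup>2) \<le> exp (- A) * 1"
      by (intro mult_left_mono) auto
    ultimately show ?case
      using gA A(3) by (auto simp: radial_limit_eq[OF L0] intro!: le_deficit)
  qed
  let ?C = "\<Sum>j<N. loss j + 2 * (ln 2 - ln (1 - cmod (r j)))"
  have bound: "\<bar>g k \<theta>\<bar> \<le> ?C" for k \<theta>
    unfolding g_def by (rule gain_bound[OF circle_in_polydisc[OF radius]])
  have lim': "AE \<theta> in angle_cube. (\<lambda>k. g k \<theta>) \<longlonglongrightarrow> G \<theta>"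
    using lim by eventually_elim simp
  have G: "integrable angle_cube G" and lim_int: "(\<lambda>k. \<integral>\<theta>. g k \<theta> \<partial>angle_cube) \<longlonglongrightarrow> (\<integral>\<theta>. G \<theta> \<partial>angle_cube)"
    using bound lim' by (auto intro!: integrable_dominated_convergence[of G angle_cube g "\<lambda>_. ?C"]
        integral_dominated_convergence[of G angle_cube g "\<lambda>_. ?C"])
  have "(\<integral>\<theta>. g k \<theta> \<partial>angle_cube) = (\<Sum>j<N. loss j)" for k
    unfolding g_def gain_def
    using integrable_ln_denom[OF radius, of _ k]
    by (subst Bochner_Integration.integral_sum)
      (auto simp: integral_ln_denom[OF radius] angle_cube.prob_space[simplified])
  then have "(\<integral>\<theta>. G \<theta> \<partial>angle_cube) = (\<Sum>j<N. loss j)"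
    using lim_int by (simp add: LIMSEQ_const_iff)
  then have "ennreal (\<Sum>j<N. loss j) \<le> (\<integral>\<^sup>+\<theta>. ennreal (G \<theta>) \<partial>angle_cube)"
    using ennreal_integral_le_nn_integral[OF G] by simp
  also have "\<dots> \<le> (\<integral>\<^sup>+\<theta>. deficit (radial_limit (h 0) (torus_point \<theta>)) \<partial>angle_cube)"
    using lim by (intro nn_integral_mono_AE) (auto elim: eventually_mono)
  finally show ?thesis .
qed

lemma deficit_radial_limit_eq_liminf:
  assumes z: "z \<in> torus" and L: "has_limit z 0 L"
  shows "deficit (radial_limit (h 0) z) = liminf (\<lambda>k. ennreal (energy 0 (radius k *\<^sub>R z)))"
proof -
  have "(\<lambda>k. h 0 (radius k *\<^sub>R z)) \<longlonglongrightarrow> L"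
    using filterlim_compose[OF L[unfolded has_limit_def] radius_tendsto] .
  moreover have "cmod (h 0 (radius k *\<^sub>R z)) < 1" for k
    by (rule h_less[OF scaled_torus_in_polydisc[OF z radius]])
  ultimately have "(\<lambda>k. ennreal (energy 0 (radius k *\<^sub>R z))) \<longlonglongrightarrow> deficit L"
    unfolding energy_def by (intro tendsto_deficit) auto
  then show ?thesis
    by (simp add: radial_limit_eq[OF L] lim_imp_Liminf)
qed

lemma energy_circle_measurable: "(\<lambda>\<theta>. energy n (radius k *\<^sub>R torus_point \<theta>)) \<in> borel_measurable borel"
  by (rule borel_measurable_continuous_onI[OF continuous_on_circle[OF energy_continuous radius]])

text \<open>
  Fatou's lemma along the radii \<open>radius k\<close>, with the bound \<open>mean_energy_le_suminf\<close> that holds for every radius.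
\<close>

lemma boundary_deficit_le_suminf_loss:
  assumes sum: "summable loss"
  shows "(\<integral>\<^sup>+\<theta>. deficit (radial_limit (h 0) (torus_point \<theta>)) \<partial>angle_cube) \<le> ennreal (suminf loss)"
proof -
  note [measurable] = energy_circle_measurable
  have "(\<integral>\<^sup>+\<theta>. deficit (radial_limit (h 0) (torus_point \<theta>)) \<partial>angle_cube)
      = (\<integral>\<^sup>+\<theta>. liminf (\<lambda>k. ennreal (energy 0 (radius k *\<^sub>R torus_point \<theta>))) \<partial>angle_cube)"
  proof (rule nn_integral_cong_AE, use AE_has_limit in eventually_elim)
    case (elim \<theta>)
    then show ?case using deficit_radial_limit_eq_liminf[OF torus_point_in_torus] by blast
  qed
  also have "\<dots> \<le> liminf (\<lambda>k. \<integral>\<^sup>+\<theta>. ennreal (energy 0 (radius k *\<^sub>R torus_point \<theta>)) \<partial>angle_cube)"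
    by (rule nn_integral_liminf) measurable
  also have "\<dots> = liminf (\<lambda>k. ennreal (mean_energy (radius k) 0))"
    unfolding mean_energy_def
    using integrable_energy[OF radius] energy_nonneg[OF circle_in_polydisc[OF radius]]
    by (subst nn_integral_eq_integral) auto
  also have "\<dots> \<le> limsup (\<lambda>k. ennreal (mean_energy (radius k) 0))"
    by (rule Liminf_le_Limsup) simp
  also have "\<dots> \<le> ennreal (suminf loss)"
    by (intro Limsup_bounded always_eventually allI ennreal_leI mean_energy_le_suminf radius sum)
  finally show ?thesis .
qed

text \<open>
  The integrand on the left need not be a Borel function off the torus. It is replaced by the Borel function
  \<open>w\<close>, with which it agrees on the Borel set \<open>R\<close> of full measure, before the integral is pulled back to the
  angles.
\<close>

lemma boundary_deficit_torus_measure: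
  "(\<integral>\<^sup>+z. deficit (radial_limit (h 0) z) \<partial>torus_measure)
    = (\<integral>\<^sup>+\<theta>. deficit (radial_limit (h 0) (torus_point \<theta>)) \<partial>angle_cube)"
proof -
  define R where "R = {z \<in> torus. \<exists>L. has_limit z 0 L}"
  have R: "R \<in> sets borel"
    unfolding R_def has_limit_def by (rule radial_convergence_set_borel[OF h_continuous])
  define w where "w z = liminf (\<lambda>k. ennreal (indicator torus z *\<^sub>R energy 0 (radius k *\<^sub>R z)))" for z
  have [measurable]: "(\<lambda>z. indicator torus z *\<^sub>R energy 0 (radius k *\<^sub>R z)) \<in> borel_measurable borel" for k
    by (rule borel_measurable_continuous_on_indicator)
      (use closed_torus in \<open>auto intro!: borel_closed continuous_on_scaled_torus energy_continuous radius\<close>)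
  have [measurable]: "w \<in> borel_measurable borel"
    unfolding w_def by measurable
  have w: "deficit (radial_limit (h 0) z) = w z" if "z \<in> R" for z
    using that deficit_radial_limit_eq_liminf[of z] by (auto simp: R_def w_def)
  have AE_R: "AE \<theta> in angle_cube. torus_point \<theta> \<in> R"
    using AE_has_limit by eventually_elim (simp add: R_def)
  have tp: "torus_point \<in> measurable angle_cube borel" by measurable
  have "AE z in torus_measure. z \<in> R"
    unfolding torus_measure_alt using R AE_R by (subst AE_distr_iff[OF tp]) auto
  then have "(\<integral>\<^sup>+z. deficit (radial_limit (h 0) z) \<partial>torus_measure) = (\<integral>\<^sup>+z. w z \<partial>torus_measure)"
    by (intro nn_integral_cong_AE) (auto simp: w elim: eventually_mono)
  also have "\<dots> = (\<integral>\<^sup>+\<theta>. w (torus_point \<theta>) \<partial>angle_cube)"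
    unfolding torus_measure_alt by (rule nn_integral_distr[OF tp]) simp
  also have "\<dots> = (\<integral>\<^sup>+\<theta>. deficit (radial_limit (h 0) (torus_point \<theta>)) \<partial>angle_cube)"
    using AE_R by (intro nn_integral_cong_AE) (auto simp: w elim: eventually_mono)
  finally show ?thesis .
qed

text \<open>
  The loss \<open>- ln (1 - x)\<close> is at least \<open>x\<close>, and at most \<open>2 * x\<close> once \<open>x\<close> is below \<open>1 / 2\<close>; here \<open>x\<close> is
  the square of \<open>cmod (r n)\<close>.
\<close>

lemma summable_loss_iff: "summable loss \<longleftrightarrow> summable (\<lambda>n. (cmod (r n))\<^sup>2)"
proof
  assume sum: "summable loss"
  have "norm ((cmod (r n))\<^sup>2) \<le> loss n" for n
    using ln_le_minus_one[of "1 - (cmod (r n))\<^sup>2"] r_sq_less[of n] by (simp add: loss_def)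
  then show "summable (\<lambda>n. (cmod (r n))\<^sup>2)"
    by (rule summable_comparison_test'[OF sum])
next
  assume sum: "summable (\<lambda>n. (cmod (r n))\<^sup>2)"
  have "(\<lambda>n. (cmod (r n))\<^sup>2) \<longlonglongrightarrow> 0" by (rule summable_LIMSEQ_zero[OF sum])
  then have "\<forall>\<^sub>F n in sequentially. (cmod (r n))\<^sup>2 < 1 / 2"
    by (rule order_tendstoD) simp
  then obtain M where M: "\<And>n. n \<ge> M \<Longrightarrow> (cmod (r n))\<^sup>2 < 1 / 2"
    unfolding eventually_sequentially by blast
  have "norm (loss n) \<le> 2 * (cmod (r n))\<^sup>2" if "n \<ge> M" for n
  proof -
    let ?x = "(cmod (r n))\<^sup>2"
    have x: "?x < 1 / 2" "0 \<le> ?x" using M[OF that] by auto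
    have "loss n = ln (1 / (1 - ?x))" using x by (simp add: loss_def ln_div)
    also have "\<dots> \<le> 1 / (1 - ?x) - 1" using x by (intro ln_le_minus_one) auto
    also have "\<dots> = ?x / (1 - ?x)" using x by (simp add: field_simps)
    also have "\<dots> \<le> ?x / (1 / 2)" using x by (intro divide_left_mono) auto
    finally show ?thesis using loss_nonneg[of n] by simp
  qed
  then show "summable loss"
    by (rule summable_comparison_test'[OF summable_mult[OF sum]])
qed

theorem boundary_deficit_eq:
  "enn2ereal (\<integral>\<^sup>+z. deficit (radial_limit (h 0) z) \<partial>torus_measure) = (\<Sum>n. ereal (loss n))"
proof -
  let ?J = "\<integral>\<^sup>+z. deficit (radial_limit (h 0) z) \<partial>torus_measure"
  have lower: "ennreal (\<Sum>j<N. loss j) \<le> ?J" for N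
    unfolding boundary_deficit_torus_measure by (rule sum_loss_le_boundary_deficit)
  show ?thesis
  proof (cases "summable loss")
    case True
    have "ennreal (suminf loss) \<le> ?J"
    proof (rule tendsto_upperbound)
      show "(\<lambda>N. ennreal (\<Sum>j<N. loss j)) \<longlonglongrightarrow> ennreal (suminf loss)"
        by (intro tendsto_ennrealI summable_LIMSEQ True)
    qed (use lower in auto)
    then have "?J = ennreal (suminf loss)"
      using boundary_deficit_le_suminf_loss[OF True] by (simp add: boundary_deficit_torus_measure)
    moreover have "(\<Sum>n. ereal (loss n)) = ereal (suminf loss)"
      using summable_sums[OF True] by (intro sums_unique[symmetric]) (simp add: sums_ereal)
    ultimately show ?thesis
      using suminf_nonneg[OF True loss_nonneg] by (simp add: enn2ereal_ennreal)
  next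
    case False
    have "?J = top"
    proof (rule ccontr)
      assume "?J \<noteq> top"
      then obtain x where "?J = ennreal x" "0 \<le> x" by (cases ?J) auto
      then have "(\<Sum>j<N. loss j) \<le> x" for N
        using lower[of N] by (simp add: ennreal_le_iff)
      then have "summable loss"
        using loss_nonneg by (intro summableI_nonneg_bounded)
      then show False using False by simp
    qed
    moreover have "(\<Sum>n. ereal (loss n)) = \<infinity>"
      using summable_ereal[of loss] loss_nonneg False by auto
    ultimately show ?thesis by simp
  qed
qed

end

section \<open>The integral formula\<close>

theorem theorem3:
  fixes f :: "complex ^ 'd \<Rightarrow> complex" and r :: "nat \<Rightarrow> complex"
  assumes "standard_schur f" and "schur_parameters f r"
  defines "lhs \<equiv> ext_integral torus_measure (\<lambda>z. ext_ln (1 - (cmod (radial_limit f z))\<^sup>2))"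
    and "rhs \<equiv> (\<Sum>j. ext_ln (1 - (cmod (r (Suc j)))\<^sup>2))"
  shows "lhs = rhs
    \<and> (\<bar>lhs\<bar> \<noteq> \<infinity> \<longleftrightarrow> summable (\<lambda>n. (cmod (r n))\<^sup>2))
    \<and> (\<bar>rhs\<bar> \<noteq> \<infinity> \<longleftrightarrow> summable (\<lambda>n. (cmod (r n))\<^sup>2))"
proof -
  obtain h :: "nat \<Rightarrow> complex ^ 'd \<Rightarrow> complex" and \<nu> :: "nat \<Rightarrow> 'd" where h0: "h 0 = f" and
    h: "\<And>n. h n \<in> schur_functions" "\<And>n. r n = h n 0"
      "\<And>n z. z \<in> polydisc \<Longrightarrow> h n z = moebius_op (r n) (mult_op (\<nu> (Suc n)) (h (Suc n))) z"
    using assms(2) unfolding schur_parameters_def by blast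
  have r_less: "cmod (r n) < 1" for n
    using assms(1,2) by (simp add: standard_schur_def)
  interpret schur_recursion h r "\<lambda>n. \<nu> (Suc n)"
    using h r_less by unfold_locales (auto simp: schur_functions_def)
  define S where "S = (\<Sum>n. ereal (loss n))"
  have "r 0 = 0" using assms(1) h(2)[of 0] h0 by (simp add: standard_schur_def)
  \<comment> \<open>The series in the theorem starts at index one; the term at index zero vanishes.\<close>
  then have loss0: "loss 0 = 0" by (simp add: loss_def)
  have "lhs = - S"
  proof -
    have "e2ennreal (ext_ln (1 - (cmod w)\<^sup>2)) = 0" for w
      by (auto simp: ext_ln_def e2ennreal_neg ln_le_zero_iff)
    then show ?thesis
      by (simp add: lhs_def ext_integral_def S_def h0 zero_ennreal.rep_eq flip: boundary_deficit_eq deficit_def)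
  qed
  moreover have "rhs = - S"
  proof -
    have nn: "0 \<le> ereal (loss n)" for n using loss_nonneg by simp
    have "(\<lambda>N. \<Sum>j<N. ereal (loss j)) \<longlonglongrightarrow> S"
      unfolding S_def by (rule summable_LIMSEQ[OF summable_ereal_pos[OF nn]])
    then have "(\<lambda>N. - (\<Sum>j<Suc N. ereal (loss j))) \<longlonglongrightarrow> - S"
      by (intro tendsto_uminus_ereal) (rule LIMSEQ_Suc)
    moreover have "- (\<Sum>j<Suc N. ereal (loss j)) = (\<Sum>j<N. ext_ln (1 - (cmod (r (Suc j)))\<^sup>2))" for N
    proof -
      have "ext_ln (1 - (cmod (r (Suc j)))\<^sup>2) = ereal (- loss (Suc j))" for j
        using r_sq_less[of "Suc j"] by (simp add: ext_ln_def loss_def)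
      then show ?thesis
        by (simp add: sum.lessThan_Suc_shift loss0 sum_negf del: sum.lessThan_Suc)
    qed
    ultimately show ?thesis
      unfolding rhs_def by (intro sums_unique[symmetric]) (simp add: sums_def)
  qed
  moreover have "\<bar>- S\<bar> \<noteq> \<infinity> \<longleftrightarrow> summable loss"
  proof
    assume "summable loss"
    then show "\<bar>- S\<bar> \<noteq> \<infinity>"
      unfolding S_def using sums_unique[OF sums_ereal[THEN iffD2, OF summable_sums]] by force
  next
    assume "\<bar>- S\<bar> \<noteq> \<infinity>"
    then have "S \<noteq> \<infinity>" by auto
    then show "summable loss"
      unfolding S_def using summable_ereal loss_nonneg by blast
  qed
  ultimately show ?thesis using summable_loss_iff by simp
qed

end
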